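(* Let $\epsilon\in\{0,\tfrac12\}$. For a Lie superalgebra homomorphism $\psi:\mathfrak{q}_\epsilon^+\to\mathbb{C}$ let $A(\psi)=\mathbb{C}w_\psi$ be the one-dimensional vector space with action $xw_\psi=\psi(x)w_\psi$ for all $x\in\mathfrak{q}_\epsilon^+$. Then every finite-dimensional simple module over $\mathfrak{q}_\epsilon^+$ is isomorphic to such an $A(\psi)$, i.e. to $A(\psi)$ for some Lie superalgebra homomorphism $\psi:\mathfrak{q}_\epsilon^+\to\mathbb{C}$.
   Context: $\mathfrak{q}_\epsilon$ is the complex Lie superalgebra with basis $\{L_m,H_m,G_r,C\mid m\in\mathbb{Z},\ r\in\mathbb{Z}+\epsilon\}$, where $L_m,H_m,C$ are even, $G_r$ is odd, $C$ is central, and $[L_m,L_n]=(n-m)L_{m+n}+\frac{1}{12}\delta_{m+n,0}(n^3-n)C$, $[H_m,H_n]=\frac13 m\delta_{m+n,0}C$, $[L_m,H_n]=nH_{m+n}$, $[L_m,G_p]=(p-\frac m2)G_{p+m}$, $[H_m,G_p]=G_{p+m}$, $[G_p,G_q]=0$. $\mathbb{Z}_+$ denotes the positive integers and $\mathbb{Z}_+-\epsilon=\{k-\epsilon\mid k\in\mathbb{Z}_+\}$. The subalgebra $\mathfrak{q}_\epsilon^+$ is $\mathrm{span}_{\mathbb{C}}\{L_m,H_n,G_r\mid m,n\in\mathbb{Z}_+,\ r\in\mathbb{Z}_+-\epsilon\}$. In a Lie superalgebra homomorphism $\psi:\mathfrak{q}_\epsilon^+\to\mathbb{C}$, $\mathbb{C}$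 is the purely even abelian Lie superalgebra. Modules are $\mathbb{Z}_2$-graded; the vector $w_\psi$ is homogeneous. *)

theory Defs
  imports Complex_Main "HOL-Library.Poly_Mapping" "HOL-Library.Z2"
begin

section \<open>Complex superspaces, Lie superalgebras and their modules\<close>

text \<open>
  The group \<open>\<int>\<^sub>2\<close> of parities is the type \<^typ>\<open>bit\<close>. A superspace lives inside an ambient
  complex vector space: the scalar multiplication is that of the ambient space, and the space
  itself is the direct sum of the two subspaces \<open>part V 0\<close> and \<open>part V 1\<close>.
  The structure maps below are only ever constrained on these subspaces.
\<close>

record 'v superspace =
  smul :: "complex \<Rightarrow> 'v \<Rightarrow> 'v"
  part :: "bit \<Rightarrow> 'v set"

record 'g liesuper = "'g superspace" +
  brk :: "'g \<Rightarrow> 'g \<Rightarrow> 'g"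

record ('g, 'v) supermodule = "'v superspace" +
  act :: "'g \<Rightarrow> 'v \<Rightarrow> 'v"

definition underlying :: "('v::ab_group_add, 'm) superspace_scheme \<Rightarrow> 'v set" where
  "underlying V = {a + b |a b. a \<in> part V 0 \<and> b \<in> part V 1}"

definition is_superspace :: "('v::ab_group_add, 'm) superspace_scheme \<Rightarrow> bool" where
  "is_superspace V \<longleftrightarrow> vector_space (smul V) \<and>
     (\<forall>i. module.subspace (smul V) (part V i)) \<and> part V 0 \<inter> part V 1 = {0}"

definition finite_dim :: "('v::ab_group_add, 'm) superspace_scheme \<Rightarrow> bool" where
  "finite_dim V \<longleftrightarrow> (\<exists>B. finite B \<and> module.span (smul V) B = underlying V)"

definition linear_between ::
    "('v::ab_group_add, 'm) superspace_scheme \<Rightarrow> ('w::ab_group_add, 'n) superspace_scheme \<Rightarrow> ('v \<Rightarrow> 'w) \<Rightarrow> bool" where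
  "linear_between V W f \<longleftrightarrow>
     (\<forall>x\<in>underlying V. f x \<in> underlying W) \<and>
     (\<forall>x\<in>underlying V. \<forall>y\<in>underlying V. f (x + y) = f x + f y) \<and>
     (\<forall>c. \<forall>x\<in>underlying V. f (smul V c x) = smul W c (f x))"

definition even_map ::
    "('v, 'm) superspace_scheme \<Rightarrow> ('w, 'n) superspace_scheme \<Rightarrow> ('v \<Rightarrow> 'w) \<Rightarrow> bool" where
  "even_map V W f \<longleftrightarrow> (\<forall>i. \<forall>x\<in>part V i. f x \<in> part W i)"

definition koszul :: "bit \<Rightarrow> bit \<Rightarrow> complex" where
  "koszul i j = (if i = 1 \<and> j = 1 then -1 else 1)"

definition is_lie_superalgebra :: "('g::ab_group_add, 'm) liesuper_scheme \<Rightarrow> bool" where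
  "is_lie_superalgebra g \<longleftrightarrow> is_superspace g \<and>
     (\<forall>x\<in>underlying g. linear_between g g (brk g x)) \<and>
     (\<forall>y\<in>underlying g. linear_between g g (\<lambda>x. brk g x y)) \<and>
     (\<forall>i j. \<forall>x\<in>part g i. \<forall>y\<in>part g j. brk g x y \<in> part g (i + j)) \<and>
     (\<forall>i j. \<forall>x\<in>part g i. \<forall>y\<in>part g j.
        brk g x y = smul g (- koszul i j) (brk g y x)) \<and>
     (\<forall>i j k. \<forall>x\<in>part g i. \<forall>y\<in>part g j. \<forall>z\<in>part g k.
        brk g x (brk g y z) = brk g (brk g x y) z + smul g (koszul i j) (brk g y (brk g x z)))"

definition is_lie_super_hom ::
    "('g::ab_group_add, 'm) liesuper_scheme \<Rightarrow> ('h::ab_group_add, 'n) liesuper_scheme \<Rightarrow> ('g \<Rightarrow> 'h) \<Rightarrow> bool" where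
  "is_lie_super_hom g h f \<longleftrightarrow> linear_between g h f \<and> even_map g h f \<and>
     (\<forall>x\<in>underlying g. \<forall>y\<in>underlying g. f (brk g x y) = brk h (f x) (f y))"

definition is_supermodule ::
    "('g::ab_group_add, 'm) liesuper_scheme \<Rightarrow> ('g, 'v::ab_group_add, 'n) supermodule_scheme \<Rightarrow> bool" where
  "is_supermodule g V \<longleftrightarrow> is_superspace V \<and>
     (\<forall>x\<in>underlying g. linear_between V V (act V x)) \<and>
     (\<forall>v\<in>underlying V. linear_between g V (\<lambda>x. act V x v)) \<and>
     (\<forall>i j. \<forall>x\<in>part g i. \<forall>v\<in>part V j. act V x v \<in> part V (i + j)) \<and>
     (\<forall>i j. \<forall>x\<in>part g i. \<forall>y\<in>part g j. \<forall>v\<in>underlying V.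
        act V (brk g x y) v = act V x (act V y v) - smul V (koszul i j) (act V y (act V x v)))"

text \<open>Submodules are graded: they contain the homogeneous components of their elements.\<close>

definition is_subsupermodule ::
    "('g::ab_group_add, 'm) liesuper_scheme \<Rightarrow> ('g, 'v::ab_group_add, 'n) supermodule_scheme \<Rightarrow> 'v set \<Rightarrow> bool" where
  "is_subsupermodule g V W \<longleftrightarrow> W \<subseteq> underlying V \<and> module.subspace (smul V) W \<and>
     (\<forall>w\<in>W. \<exists>a\<in>W \<inter> part V 0. \<exists>b\<in>W \<inter> part V 1. w = a + b) \<and>
     (\<forall>x\<in>underlying g. \<forall>w\<in>W. act V x w \<in> W)"

definition is_simple_supermodule ::
    "('g::ab_group_add, 'm) liesuper_scheme \<Rightarrow> ('g, 'v::ab_group_add, 'n) supermodule_scheme \<Rightarrow> bool" where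
  "is_simple_supermodule g V \<longleftrightarrow> is_supermodule g V \<and> underlying V \<noteq> {0} \<and>
     (\<forall>W. is_subsupermodule g V W \<longrightarrow> W = {0} \<or> W = underlying V)"

definition supermodule_isomorphic ::
    "('g::ab_group_add, 'm) liesuper_scheme \<Rightarrow> ('g, 'v::ab_group_add, 'n) supermodule_scheme \<Rightarrow>
       ('g, 'w::ab_group_add, 'l) supermodule_scheme \<Rightarrow> bool" where
  "supermodule_isomorphic g V W \<longleftrightarrow>
     (\<exists>f. linear_between V W f \<and> even_map V W f \<and> bij_betw f (underlying V) (underlying W) \<and>
        (\<forall>x\<in>underlying g. \<forall>v\<in>underlying V. f (act V x v) = act W x (f v)))"

text \<open>The field \<open>\<complex>\<close> as a purely even abelian Lie superalgebra.\<close>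

definition trivial_lie :: "complex liesuper" where
  "trivial_lie = \<lparr>smul = (*), part = (\<lambda>i. if i = 0 then UNIV else {0}), brk = (\<lambda>_ _. 0)\<rparr>"

section \<open>The Lie superalgebra \<open>q\<^sub>\<epsilon>\<close> and its positive part\<close>

text \<open>
  The ambient space has basis \<open>L\<^sub>m\<close>, \<open>H\<^sub>m\<close>, \<open>G\<^sub>p\<close>, \<open>C\<close> with \<open>p\<close> ranging over all real numbers; the
  restriction \<open>p \<in> \<int> + \<epsilon>\<close> enters through the subspaces selected in \<open>qq\<close>.
\<close>

datatype qidx = Lx int | Hx int | Gx real | Cx

type_synonym qvec = "qidx \<Rightarrow>\<^sub>0 complex"

definition qscale :: "complex \<Rightarrow> qvec \<Rightarrow> qvec" where
  "qscale c x = Poly_Mapping.map ((*) c) x"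

abbreviation qbasis :: "qidx \<Rightarrow> qvec" where
  "qbasis a \<equiv> Poly_Mapping.single a 1"

fun parity :: "qidx \<Rightarrow> bit" where
  "parity (Gx p) = 1"
| "parity _ = 0"

text \<open>
  The bracket on basis vectors; the equations with arguments in the opposite order come from
  super skew-symmetry, and \<open>qbrk\<close> is the bilinear extension.
\<close>

fun bbrk :: "qidx \<Rightarrow> qidx \<Rightarrow> qvec" where
  "bbrk (Lx m) (Lx n) = qscale (of_int (n - m)) (qbasis (Lx (m + n)))
     + (if m + n = 0 then qscale ((of_int n ^ 3 - of_int n) / 12) (qbasis Cx) else 0)"
| "bbrk (Hx m) (Hx n) = (if m + n = 0 then qscale (of_int m / 3) (qbasis Cx) else 0)"
| "bbrk (Lx m) (Hx n) = qscale (of_int n) (qbasis (Hx (m + n)))"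
| "bbrk (Hx n) (Lx m) = - qscale (of_int n) (qbasis (Hx (m + n)))"
| "bbrk (Lx m) (Gx p) = qscale (of_real (p - of_int m / 2)) (qbasis (Gx (p + of_int m)))"
| "bbrk (Gx p) (Lx m) = - qscale (of_real (p - of_int m / 2)) (qbasis (Gx (p + of_int m)))"
| "bbrk (Hx m) (Gx p) = qbasis (Gx (p + of_int m))"
| "bbrk (Gx p) (Hx m) = - qbasis (Gx (p + of_int m))"
| "bbrk (Gx p) (Gx q) = 0"
| "bbrk Cx _ = 0"
| "bbrk _ Cx = 0"

definition qbrk :: "qvec \<Rightarrow> qvec \<Rightarrow> qvec" where
  "qbrk x y = (\<Sum>a\<in>Poly_Mapping.keys x. \<Sum>b\<in>Poly_Mapping.keys y.
      qscale (Poly_Mapping.lookup x a * Poly_Mapping.lookup y b) (bbrk a b))"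

definition qindices :: "real \<Rightarrow> qidx set" where
  "qindices \<epsilon> = range Lx \<union> range Hx \<union> {Gx (of_int k + \<epsilon>) |k. True} \<union> {Cx}"

definition qindices_pos :: "real \<Rightarrow> qidx set" where
  "qindices_pos \<epsilon> = {Lx m |m. m > 0} \<union> {Hx n |n. n > 0} \<union> {Gx (of_int k - \<epsilon>) |k. k > 0}"

definition qq :: "real \<Rightarrow> qvec liesuper" where
  "qq \<epsilon> = \<lparr>smul = qscale,
           part = (\<lambda>i. module.span qscale (qbasis ` {a \<in> qindices \<epsilon>. parity a = i})),
           brk = qbrk\<rparr>"

definition qq_pos :: "real \<Rightarrow> qvec liesuper" where
  "qq_pos \<epsilon> = (qq \<epsilon>)\<lparr>part := \<lambda>i. part (qq \<epsilon>) i \<inter> module.span qscale (qbasis ` qindices_pos \<epsilon>)\<rparr>"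

text \<open>
  The module \<open>A(\<psi>) = \<complex> w\<close>, realised on \<open>\<complex>\<close> with \<open>w = 1\<close>. The homogeneous vector \<open>w\<close> may have either
  parity, recorded by the second argument.
\<close>

definition A_module :: "(qvec \<Rightarrow> complex) \<Rightarrow> bit \<Rightarrow> (qvec, complex) supermodule" where
  "A_module \<psi> p = \<lparr>smul = (*), part = (\<lambda>i. if i = p then UNIV else {0}),
                   act = (\<lambda>x z. \<psi> x * z)\<rparr>"

section \<open>The definitions satisfy the axioms they are meant to satisfy\<close>

lemma lookup_qscale [simp]: "Poly_Mapping.lookup (qscale c x) k = c * Poly_Mapping.lookup x k"
  by (simp add: qscale_def Poly_Mapping.map.rep_eq when_def)

interpretation qvs: vector_space qscale
  by unfold_locales (auto intro!: poly_mapping_eqI simp: lookup_add algebra_simps)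

lemma keys_qscale: "Poly_Mapping.keys (qscale c x) \<subseteq> Poly_Mapping.keys x"
  by (auto simp: in_keys_iff)

lemma keys_subsetI:
  fixes x y :: qvec
  shows
  "Poly_Mapping.keys x \<subseteq> I \<Longrightarrow> Poly_Mapping.keys y \<subseteq> I \<Longrightarrow> Poly_Mapping.keys (x + y) \<subseteq> I"
  "Poly_Mapping.keys x \<subseteq> I \<Longrightarrow> Poly_Mapping.keys (qscale c x) \<subseteq> I"
  "Poly_Mapping.keys x \<subseteq> I \<Longrightarrow> Poly_Mapping.keys (- x) \<subseteq> I"
  "d \<in> I \<Longrightarrow> Poly_Mapping.keys (qbasis d) \<subseteq> I"
  "(P \<Longrightarrow> Poly_Mapping.keys x \<subseteq> I) \<Longrightarrow> Poly_Mapping.keys (if P then x else 0) \<subseteq> I"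
  using Poly_Mapping.keys_add[of x y] keys_qscale[of c x] by auto

lemma subspace_keys: "qvs.subspace {x. Poly_Mapping.keys x \<subseteq> I}"
  by (rule qvs.subspaceI) (simp_all add: keys_subsetI)

lemma qvec_expand: "x = (\<Sum>a\<in>Poly_Mapping.keys x. qscale (Poly_Mapping.lookup x a) (qbasis a))"
proof (rule poly_mapping_eqI)
  fix k
  have "(\<Sum>a\<in>Poly_Mapping.keys x. Poly_Mapping.lookup x a * (1 when a = k)) =
      (\<Sum>a\<in>Poly_Mapping.keys x. if a = k then Poly_Mapping.lookup x k else 0)"
    by (rule sum.cong) (simp_all add: when_def)
  then show "Poly_Mapping.lookup x k =
      Poly_Mapping.lookup (\<Sum>a\<in>Poly_Mapping.keys x. qscale (Poly_Mapping.lookup x a) (qbasis a)) k"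
    by (simp add: lookup_sum lookup_single in_keys_iff)
qed

lemma span_qbasis: "qvs.span (qbasis ` I) = {x. Poly_Mapping.keys x \<subseteq> I}"
proof
  show "qvs.span (qbasis ` I) \<subseteq> {x. Poly_Mapping.keys x \<subseteq> I}"
    by (rule qvs.span_minimal[OF _ subspace_keys]) auto
  show "{x. Poly_Mapping.keys x \<subseteq> I} \<subseteq> qvs.span (qbasis ` I)"
  proof clarify
    fix x :: qvec assume "Poly_Mapping.keys x \<subseteq> I"
    then have "(\<Sum>a\<in>Poly_Mapping.keys x. qscale (Poly_Mapping.lookup x a) (qbasis a)) \<in> qvs.span (qbasis ` I)"
      by (intro qvs.span_sum qvs.span_scale qvs.span_base) auto
    then show "x \<in> qvs.span (qbasis ` I)" by (simp flip: qvec_expand)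
  qed
qed

lemma qvec_induct [consumes 1, case_names zero add scale basis]:
  assumes "Poly_Mapping.keys x \<subseteq> I"
    and "P 0" "\<And>x y. P x \<Longrightarrow> P y \<Longrightarrow> P (x + y)" "\<And>c x. P x \<Longrightarrow> P (qscale c x)"
    and "\<And>a. a \<in> I \<Longrightarrow> P (qbasis a)"
  shows "P x"
proof -
  have "x \<in> qvs.span (qbasis ` I)" using assms(1) by (simp add: span_qbasis)
  moreover have "qvs.subspace (Collect P)" using assms by (auto intro!: qvs.subspaceI)
  ultimately show ?thesis using assms(5) by (auto intro: qvs.span_induct)
qed

lemma qbrk_superset:
  assumes "finite A" "finite B" "Poly_Mapping.keys x \<subseteq> A" "Poly_Mapping.keys y \<subseteq> B"
  shows "qbrk x y = (\<Sum>a\<in>A. \<Sum>b\<in>B.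
      qscale (Poly_Mapping.lookup x a * Poly_Mapping.lookup y b) (bbrk a b))"
proof -
  have "qbrk x y = (\<Sum>a\<in>Poly_Mapping.keys x. \<Sum>b\<in>B.
      qscale (Poly_Mapping.lookup x a * Poly_Mapping.lookup y b) (bbrk a b))"
    unfolding qbrk_def using assms
    by (intro sum.cong refl sum.mono_neutral_left) (auto simp: in_keys_iff)
  also have "\<dots> = (\<Sum>a\<in>A. \<Sum>b\<in>B.
      qscale (Poly_Mapping.lookup x a * Poly_Mapping.lookup y b) (bbrk a b))"
    using assms by (intro sum.mono_neutral_left) (auto simp: in_keys_iff)
  finally show ?thesis .
qed

lemma qbrk_add_left: "qbrk (x + x') y = qbrk x y + qbrk x' y"
proof -
  let ?A = "Poly_Mapping.keys x \<union> Poly_Mapping.keys x'" and ?B = "Poly_Mapping.keys y"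
  have "Poly_Mapping.keys (x + x') \<subseteq> ?A" by (rule Poly_Mapping.keys_add)
  then show ?thesis
    by (simp add: qbrk_superset[of ?A ?B] lookup_add qvs.scale_left_distrib
        distrib_right sum.distrib)
qed

lemma qbrk_add_right: "qbrk x (y + y') = qbrk x y + qbrk x y'"
proof -
  let ?A = "Poly_Mapping.keys x" and ?B = "Poly_Mapping.keys y \<union> Poly_Mapping.keys y'"
  have "Poly_Mapping.keys (y + y') \<subseteq> ?B" by (rule Poly_Mapping.keys_add)
  then show ?thesis
    by (simp add: qbrk_superset[of ?A ?B] lookup_add qvs.scale_left_distrib
        distrib_left sum.distrib)
qed

lemma qbrk_scale_left: "qbrk (qscale c x) y = qscale c (qbrk x y)"
  using keys_qscale[of c x]
  by (simp add: qbrk_superset[of "Poly_Mapping.keys x" "Poly_Mapping.keys y"]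
      qvs.scale_sum_right mult.assoc)

lemma qbrk_scale_right: "qbrk x (qscale c y) = qscale c (qbrk x y)"
  using keys_qscale[of c y]
  by (simp add: qbrk_superset[of "Poly_Mapping.keys x" "Poly_Mapping.keys y"]
      qvs.scale_sum_right mult.left_commute)

lemma qbrk_zero [simp]: "qbrk 0 y = 0" "qbrk x 0 = 0"
  by (simp_all add: qbrk_def)

lemma qbrk_uminus: "qbrk (- x) y = - qbrk x y" "qbrk x (- y) = - qbrk x y"
  using qbrk_scale_left[of "-1" x y] qbrk_scale_right[of x "-1" y] by simp_all

lemma qbrk_basis: "qbrk (qbasis a) (qbasis b) = bbrk a b"
  by (simp add: qbrk_def)

lemmas qbrk_linear = qbrk_add_left qbrk_add_right qbrk_scale_left qbrk_scale_right qbrk_uminus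

lemma bbrk_parity: "Poly_Mapping.keys (bbrk a b) \<subseteq> {c. parity c = parity a + parity b}"
  by (cases a; cases b; simp only: bbrk.simps; (intro keys_subsetI)?; simp)

lemma bbrk_Cx [simp]: "bbrk a Cx = 0"
  by (cases a) auto

lemma koszul_simps [simp]: "koszul 0 i = 1" "koszul i 0 = 1" "koszul 1 1 = -1"
  by (auto simp: koszul_def)

lemma lookup_if_zero:
  "Poly_Mapping.lookup (if P then x else 0) k = (if P then Poly_Mapping.lookup x k else 0)"
  by simp

lemma int_add_eq_0_cases:
  fixes m n :: int
  obtains "m + n \<noteq> 0" | "n = - m"
  by linarith

lemma bbrk_skew: "bbrk a b = qscale (- koszul (parity a) (parity b)) (bbrk b a)"
proof (rule poly_mapping_eqI, goal_cases)
  case (1 k)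
  show ?case
    apply (cases a; cases b)
    apply (simp_all only: bbrk.simps parity.simps koszul_simps bbrk_Cx lookup_add lookup_qscale
        lookup_uminus lookup_zero lookup_if_zero mult_zero_right mult_minus_left mult_1_left
        minus_minus minus_zero qvs.scale_zero_right)
    subgoal for m n
      by (rule int_add_eq_0_cases[of m n]) (simp_all add: add.commute[of n m] field_simps)
    subgoal for m n
      by (rule int_add_eq_0_cases[of m n]) (simp_all add: add.commute[of n m])
    done
qed

lemma qbrk_if: "qbrk (if P then x else 0) y = (if P then qbrk x y else 0)"
  "qbrk x (if P then y else 0) = (if P then qbrk x y else 0)"
  by simp_all

lemma qbrk_Cx: "qbrk (qbasis Cx) y = 0" "qbrk x (qbasis Cx) = 0"
  by (simp_all add: qbrk_def)

lemma bbrk_jacobi: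
  "qbrk (qbasis a) (bbrk b c) =
     qbrk (bbrk a b) (qbasis c) + qscale (koszul (parity a) (parity b)) (qbrk (qbasis b) (bbrk a c))"
proof (rule poly_mapping_eqI, goal_cases)
  case (1 k)
  have three: thesis if "m + (n + p) \<noteq> 0 \<Longrightarrow> thesis" "p = - m - n \<Longrightarrow> thesis" for m n p :: int and thesis
    using that by linarith
  show ?case
    apply (cases a; cases b; cases c)
    apply (simp_all only: bbrk.simps bbrk_Cx parity.simps koszul_simps)
    apply (simp_all only: qbrk_linear qbrk_if qbrk_basis qbrk_Cx bbrk.simps qbrk_zero
        qvs.scale_zero_right lookup_add lookup_qscale lookup_uminus lookup_zero lookup_if_zero if_cancel
        add_0_left add_0_right mult_zero_right mult_1_left minus_zero)
    apply (simp_all only: lookup_single when_def add_ac of_int_add)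
    apply (simp_all add: field_simps split del: if_split)
    subgoal for m n p
      by (rule three[of m n p], simp, hypsubst, simp add: field_simps power3_eq_cube)
    subgoal for m n p
      by (rule three[of m n p], simp, hypsubst, simp add: field_simps)
    subgoal for m n p
      by (rule three[of m n p], simp, hypsubst, simp add: field_simps)
    subgoal for m n p
      by (rule three[of m n p], simp, hypsubst, simp add: field_simps)
    done
qed

definition span_part :: "qidx set \<Rightarrow> bit \<Rightarrow> qvec set" where
  "span_part I i = {x. Poly_Mapping.keys x \<subseteq> {a \<in> I. parity a = i}}"

lemma span_part_sum:
  "{a + b |a b. a \<in> span_part I 0 \<and> b \<in> span_part I 1} = {x. Poly_Mapping.keys x \<subseteq> I}"
proof (intro equalityI subsetI)
  fix x assume "x \<in> {a + b |a b. a \<in> span_part I 0 \<and> b \<in> span_part I 1}"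
  then show "x \<in> {x. Poly_Mapping.keys x \<subseteq> I}"
    using Poly_Mapping.keys_add by (fastforce simp: span_part_def)
next
  fix x :: qvec assume "x \<in> {x. Poly_Mapping.keys x \<subseteq> I}"
  then have "Poly_Mapping.keys x \<subseteq> I" by simp
  then have "x \<in> qvs.span (qbasis ` ({a \<in> I. parity a = 0} \<union> {a \<in> I. parity a = 1}))"
    by (auto simp: span_qbasis)
  then show "x \<in> {a + b |a b. a \<in> span_part I 0 \<and> b \<in> span_part I 1}"
    unfolding image_Un qvs.span_Un span_part_def span_qbasis by auto
qed

lemma bilinear_closed:
  assumes "Poly_Mapping.keys x \<subseteq> A" "Poly_Mapping.keys y \<subseteq> B"
    and "\<And>a b. a \<in> A \<Longrightarrow> b \<in> B \<Longrightarrow> Poly_Mapping.keys (bbrk a b) \<subseteq> D"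
  shows "Poly_Mapping.keys (qbrk x y) \<subseteq> D"
proof -
  have "bbrk a b \<in> qvs.span (qbasis ` D)"
    if "a \<in> Poly_Mapping.keys x" "b \<in> Poly_Mapping.keys y" for a b
    using assms that unfolding span_qbasis by blast
  then have "qbrk x y \<in> qvs.span (qbasis ` D)"
    unfolding qbrk_def by (intro qvs.span_sum qvs.span_scale)
  then show ?thesis by (simp add: span_qbasis)
qed

lemma qbrk_skew:
  assumes "Poly_Mapping.keys x \<subseteq> {a \<in> I. parity a = i}" "Poly_Mapping.keys y \<subseteq> {a \<in> I. parity a = j}"
  shows "qbrk x y = qscale (- koszul i j) (qbrk y x)"
  using assms(1)
proof (induction x rule: qvec_induct)
  case (basis a)
  note a = this
  show ?case using assms(2)
  proof (induction y rule: qvec_induct)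
    case (basis b)
    then show ?case using a bbrk_skew[of a b] by (simp add: qbrk_basis)
  qed (simp_all add: qbrk_linear qvs.scale_right_distrib mult.commute)
qed (simp_all add: qbrk_linear qvs.scale_right_distrib mult.commute)

lemma qbrk_jacobi:
  assumes "Poly_Mapping.keys x \<subseteq> {a \<in> I. parity a = i}" "Poly_Mapping.keys y \<subseteq> {a \<in> I. parity a = j}"
  shows "qbrk x (qbrk y z) = qbrk (qbrk x y) z + qscale (koszul i j) (qbrk y (qbrk x z))"
  using assms(1)
proof (induction x rule: qvec_induct)
  case (basis a)
  note a = this
  show ?case using assms(2)
  proof (induction y rule: qvec_induct)
    case (basis b)
    note b = this
    have "Poly_Mapping.keys z \<subseteq> UNIV" by simp
    then show ?case
    proof (induction z rule: qvec_induct)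
      case (basis c)
      then show ?case using a b bbrk_jacobi[of a b c] by (simp add: qbrk_basis)
    qed (simp_all add: qbrk_linear qvs.scale_right_distrib mult.commute add_ac)
  qed (simp_all add: qbrk_linear qvs.scale_right_distrib mult.commute add_ac)
qed (simp_all add: qbrk_linear qvs.scale_right_distrib mult.commute add_ac)

lemma is_lie_superalgebra_span:
  assumes closed: "\<And>a b. a \<in> I \<Longrightarrow> b \<in> I \<Longrightarrow> Poly_Mapping.keys (bbrk a b) \<subseteq> I"
  shows "is_lie_superalgebra \<lparr>smul = qscale, part = span_part I, brk = qbrk\<rparr>"
proof -
  let ?g = "\<lparr>smul = qscale, part = span_part I, brk = qbrk\<rparr>"
  have underlying: "underlying ?g = {x. Poly_Mapping.keys x \<subseteq> I}"
    using span_part_sum[of I] by (simp add: underlying_def)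
  have "span_part I 0 \<inter> span_part I 1 = {0}"
  proof -
    have "x = 0" if "x \<in> span_part I 0" "x \<in> span_part I 1" for x
    proof -
      have "Poly_Mapping.keys x \<subseteq> {}" using that by (fastforce simp: span_part_def)
      then show ?thesis by simp
    qed
    then show ?thesis by (auto simp: span_part_def)
  qed
  then have super: "is_superspace ?g"
    unfolding is_superspace_def by (simp add: qvs.vector_space_axioms span_part_def subspace_keys)
  have cl: "Poly_Mapping.keys (qbrk x y) \<subseteq> I"
    if "Poly_Mapping.keys x \<subseteq> I" "Poly_Mapping.keys y \<subseteq> I" for x y
    using that by (rule bilinear_closed) (rule closed)
  have lin: "linear_between ?g ?g (qbrk x)" "linear_between ?g ?g (\<lambda>y. qbrk y x)"
    if "x \<in> underlying ?g" for x
    using that cl unfolding linear_between_def underlying by (simp_all add: qbrk_linear)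
  have gr: "qbrk x y \<in> span_part I (i + j)" if "x \<in> span_part I i" "y \<in> span_part I j" for x y i j
  proof -
    have bb: "Poly_Mapping.keys (bbrk a b) \<subseteq> {c \<in> I. parity c = i + j}"
      if "a \<in> {a \<in> I. parity a = i}" "b \<in> {b \<in> I. parity b = j}" for a b
      using that closed[of a b] bbrk_parity[of a b] by auto
    have x: "Poly_Mapping.keys x \<subseteq> {a \<in> I. parity a = i}"
      and y: "Poly_Mapping.keys y \<subseteq> {b \<in> I. parity b = j}"
      using that by (simp_all add: span_part_def)
    have "Poly_Mapping.keys (qbrk x y) \<subseteq> {c \<in> I. parity c = i + j}"
      by (rule bilinear_closed[OF x y bb])
    then show ?thesis by (simp add: span_part_def)
  qed
  have skew: "qbrk x y = qscale (- koszul i j) (qbrk y x)"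
    if "x \<in> span_part I i" "y \<in> span_part I j" for x y i j
    using that unfolding span_part_def mem_Collect_eq by (rule qbrk_skew)
  have jac: "qbrk x (qbrk y z) = qbrk (qbrk x y) z + qscale (koszul i j) (qbrk y (qbrk x z))"
    if "x \<in> span_part I i" "y \<in> span_part I j" for x y z i j
    using that unfolding span_part_def mem_Collect_eq by (rule qbrk_jacobi)
  show ?thesis
    unfolding is_lie_superalgebra_def superspace.simps liesuper.simps
    by (intro conjI allI ballI) (assumption | rule super lin gr skew jac)+
qed

lemma part_qq: "part (qq \<epsilon>) = span_part (qindices \<epsilon>)"
  by (rule ext) (auto simp: qq_def span_part_def span_qbasis)

lemma qindices_mem:
  "Lx m \<in> qindices \<epsilon>" "Hx m \<in> qindices \<epsilon>" "Cx \<in> qindices \<epsilon>"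
  by (simp_all add: qindices_def)

lemma qindices_shift:
  assumes "Gx p \<in> qindices \<epsilon>" shows "Gx (p + of_int m) \<in> qindices \<epsilon>"
proof -
  obtain k where "p = of_int k + \<epsilon>" using assms by (auto simp: qindices_def)
  then have "Gx (p + of_int m) = Gx (of_int (k + m) + \<epsilon>)" by simp
  then show ?thesis unfolding qindices_def by blast
qed

lemma qq_is_lie_superalgebra: "is_lie_superalgebra (qq \<epsilon>)"
proof -
  have *: "Poly_Mapping.keys (bbrk a b) \<subseteq> qindices \<epsilon>"
    if "a \<in> qindices \<epsilon>" "b \<in> qindices \<epsilon>" for a b
    using that
    by (cases a; cases b; simp only: bbrk.simps bbrk_Cx; (intro keys_subsetI)?)
       (simp_all add: qindices_mem qindices_shift)
  have "qq \<epsilon> = \<lparr>smul = qscale, part = span_part (qindices \<epsilon>), brk = qbrk\<rparr>"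
    using part_qq[of \<epsilon>] by (simp add: qq_def)
  then show ?thesis using is_lie_superalgebra_span[OF *] by simp
qed

lemma qindices_pos_subset:
  assumes "\<epsilon> \<in> {0, 1/2}" shows "qindices_pos \<epsilon> \<subseteq> qindices \<epsilon>"
proof
  fix a assume "a \<in> qindices_pos \<epsilon>"
  then consider "a \<in> qindices \<epsilon>" | k where "a = Gx (of_int k - \<epsilon>)" "k > 0"
    by (auto simp: qindices_pos_def qindices_def)
  then show "a \<in> qindices \<epsilon>"
  proof cases
    case 2
    show ?thesis
    proof (cases "\<epsilon> = 0")
      case True then show ?thesis using 2 by (auto simp: qindices_def)
    next
      case False
      then have "of_int k - \<epsilon> = of_int (k - 1) + \<epsilon>" using assms by auto
      then have "a = Gx (of_int (k - 1) + \<epsilon>)" using 2 by simp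
      then show ?thesis unfolding qindices_def by blast
    qed
  qed
qed

lemma part_qq_pos:
  "\<epsilon> \<in> {0, 1/2} \<Longrightarrow> part (qq_pos \<epsilon>) = span_part (qindices_pos \<epsilon>)"
  using qindices_pos_subset[of \<epsilon>]
  by (intro ext) (auto simp: qq_pos_def part_qq span_part_def span_qbasis)

lemma underlying_qq_pos:
  "\<epsilon> \<in> {0, 1/2} \<Longrightarrow> underlying (qq_pos \<epsilon>) = module.span qscale (qbasis ` qindices_pos \<epsilon>)"
  by (simp add: underlying_def part_qq_pos span_part_sum span_qbasis)

lemma qindices_pos_mem:
  "Lx m \<in> qindices_pos \<epsilon> \<longleftrightarrow> m > 0" "Hx m \<in> qindices_pos \<epsilon> \<longleftrightarrow> m > 0" "Cx \<notin> qindices_pos \<epsilon>"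
  by (simp_all add: qindices_pos_def)

lemma qindices_pos_shift:
  assumes "Gx p \<in> qindices_pos \<epsilon>" "m > 0" shows "Gx (p + of_int m) \<in> qindices_pos \<epsilon>"
proof -
  obtain k where "p = of_int k - \<epsilon>" "k > 0" using assms by (auto simp: qindices_pos_def)
  then have "Gx (p + of_int m) = Gx (of_int (k + m) - \<epsilon>)" "k + m > 0" using assms by simp_all
  then show ?thesis unfolding qindices_pos_def by blast
qed

lemma qq_pos_is_lie_superalgebra:
  assumes "\<epsilon> \<in> {0, 1/2}" shows "is_lie_superalgebra (qq_pos \<epsilon>)"
proof -
  have *: "Poly_Mapping.keys (bbrk a b) \<subseteq> qindices_pos \<epsilon>"
    if "a \<in> qindices_pos \<epsilon>" "b \<in> qindices_pos \<epsilon>" for a b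
    using that
    by (cases a; cases b; simp only: bbrk.simps bbrk_Cx; (intro keys_subsetI)?)
       (simp_all add: qindices_pos_mem qindices_pos_shift)
  have "qq_pos \<epsilon> = \<lparr>smul = qscale, part = span_part (qindices_pos \<epsilon>), brk = qbrk\<rparr>"
    using part_qq_pos[OF assms] by (simp add: qq_pos_def qq_def)
  then show ?thesis using is_lie_superalgebra_span[OF *] by simp
qed

lemma vector_space_complex: "vector_space ((*) :: complex \<Rightarrow> complex \<Rightarrow> complex)"
  by unfold_locales (simp_all add: algebra_simps)

lemma trivial_lie_is_lie_superalgebra: "is_lie_superalgebra trivial_lie"
proof -
  interpret c: vector_space "(*) :: complex \<Rightarrow> complex \<Rightarrow> complex" by (rule vector_space_complex)
  show ?thesis
    by (auto simp: is_lie_superalgebra_def is_superspace_def trivial_lie_def linear_between_def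
        underlying_def vector_space_complex intro!: c.subspaceI)
qed

lemma A_module_is_superspace: "is_superspace (A_module \<psi> p)"
proof -
  interpret c: vector_space "(*) :: complex \<Rightarrow> complex \<Rightarrow> complex" by (rule vector_space_complex)
  show ?thesis
    by (cases p) (auto simp: is_superspace_def A_module_def vector_space_complex intro!: c.subspaceI)
qed

lemma A_module_is_supermodule:
  assumes "is_lie_super_hom (qq_pos \<epsilon>) trivial_lie \<psi>" and "\<epsilon> \<in> {0, 1/2}"
  shows "is_supermodule (qq_pos \<epsilon>) (A_module \<psi> p)"
proof -
  have underlying: "underlying (A_module \<psi> p) = UNIV"
    by (cases p) (auto simp: underlying_def A_module_def)
  have mem: "x \<in> underlying (qq_pos \<epsilon>)" if "x \<in> part (qq_pos \<epsilon>) i" for x i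
    using that unfolding underlying_def part_qq_pos[OF assms(2)] span_part_sum
    by (auto simp: span_part_def)
  have odd: "\<psi> x = 0" if "x \<in> part (qq_pos \<epsilon>) 1" for x
    using assms(1) that by (fastforce simp: is_lie_super_hom_def even_map_def trivial_lie_def)
  let ?g = "qq_pos \<epsilon>" and ?A = "A_module \<psi> p"
  have brk: "\<psi> (brk ?g x y) = 0" if "x \<in> underlying ?g" "y \<in> underlying ?g" for x y
    using assms(1) that by (simp add: is_lie_super_hom_def trivial_lie_def)
  have act: "act ?A x v = \<psi> x * v" and smul: "smul ?A = (*)" for x v
    by (simp_all add: A_module_def)
  have psi_add: "\<psi> (x + y) = \<psi> x + \<psi> y" if "x \<in> underlying ?g" "y \<in> underlying ?g" for x y
    using assms(1) that by (simp add: is_lie_super_hom_def linear_between_def)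
  have psi_smul: "\<psi> (smul ?g c x) = c * \<psi> x" if "x \<in> underlying ?g" for c x
    using assms(1) that by (simp add: is_lie_super_hom_def linear_between_def trivial_lie_def)
  have lin1: "linear_between ?A ?A (act ?A x)" for x
    unfolding linear_between_def underlying act smul by (simp add: algebra_simps)
  have lin2: "linear_between ?g ?A (\<lambda>x. act ?A x v)" for v
    unfolding linear_between_def underlying act smul
    by (simp add: psi_add psi_smul distrib_right)
  have gr: "act ?A x v \<in> part ?A (i + j)" if "x \<in> part ?g i" "v \<in> part ?A j" for x v i j
    using that odd[of x] unfolding act by (cases i) (auto simp: A_module_def split: if_splits)
  have comm: "act ?A (brk ?g x y) v = act ?A x (act ?A y v) - smul ?A (koszul i j) (act ?A y (act ?A x v))"
    if "x \<in> part ?g i" "y \<in> part ?g j" for x y v i j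
    unfolding act smul brk[OF mem mem, OF that] using that odd[of x] odd[of y]
    by (cases i; cases j) simp_all
  show ?thesis
    unfolding is_supermodule_def
    by (intro conjI allI ballI) (assumption | rule A_module_is_superspace lin1 lin2 gr comm)+
qed

end

theory Submission
  imports Defs "HOL-Library.Function_Algebras" "HOL-Computational_Algebra.Fundamental_Theorem_Algebra"
begin

text \<open>
  Let \<open>V\<close> be a finite-dimensional simple module over the positive part. It is one-dimensional
  because every basis element other than \<open>L\<^sub>1\<close>, \<open>L\<^sub>2\<close>, \<open>H\<^sub>1\<close> acts as \<open>0\<close>, and these three then commute.
  Finite dimension forces the vanishing in high degrees; from there it descends.

  High degrees (\<open>L_eventually_zero\<close>). The operators of the \<open>L\<^sub>n\<close>, \<open>n \<ge> N\<close>, span a decreasing chain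
  of finite-dimensional spaces, which is eventually equal to one space \<open>U\<close>. As
  \<open>[L\<^sub>m, L\<^sub>n] = (n - m) L\<^sub>m\<^sub>+\<^sub>n\<close>, every map \<open>[L\<^sub>m, _]\<close> sends \<open>U\<close> onto \<open>U\<close>, and so it is injective on
  \<open>U\<close>. For large \<open>m\<close> the operator of \<open>L\<^sub>m\<close> itself lies in \<open>U\<close> and is killed by \<open>[L\<^sub>m, _]\<close>, hence it
  is \<open>0\<close>. Since \<open>[L\<^sub>m, H\<^sub>n] = n H\<^sub>m\<^sub>+\<^sub>n\<close> and \<open>[H\<^sub>m, G\<^sub>p] = G\<^sub>m\<^sub>+\<^sub>p\<close>, the \<open>H\<^sub>n\<close> and \<open>G\<^sub>p\<close> of high degree also
  act as \<open>0\<close>.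

  Descent (\<open>G_zero\<close>, \<open>H_zero\<close>, \<open>L_zero\<close>). If all generators of one kind beyond a given degree act
  as \<open>0\<close>, the one of that degree supercommutes with the whole action, and a form of Schur's lemma
  (\<open>homogeneous_kernel\<close>) applies to it. An odd one squares to \<open>0\<close>, so it has a nonzero kernel and
  vanishes. An even one is a scalar \<open>\<lambda>\<close>; if it is also, up to a nonzero factor, a commutator of
  two operators, then \<open>\<lambda> = 0\<close>, because two operators on a nonzero finite-dimensional space in
  characteristic \<open>0\<close> cannot have a nonzero scalar as their commutator (\<open>scalar_commutator_zero\<close>).
  This removes all \<open>G\<^sub>p\<close>, then \<open>H\<^sub>n = [L\<^sub>n\<^sub>-\<^sub>1, H\<^sub>1]\<close> for \<open>n \<ge> 2\<close>, and then
  \<open>(n - 2) L\<^sub>n = [L\<^sub>1, L\<^sub>n\<^sub>-\<^sub>1]\<close> for \<open>n \<ge> 3\<close>.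

  What is left commutes, so every basis element acts as a scalar. Any homogeneous nonzero vector
  then spans a submodule, and the scalars are the values of the required character.
\<close>

section \<open>Linear algebra\<close>

definition poly_action ::
    "('a::field \<Rightarrow> 'b::ab_group_add \<Rightarrow> 'b) \<Rightarrow> ('b \<Rightarrow> 'b) \<Rightarrow> 'a poly \<Rightarrow> 'b \<Rightarrow> 'b" where
  "poly_action scale T p v = (\<Sum>i\<le>degree p. scale (coeff p i) ((T ^^ i) v))"

context vector_space
begin

lemma dim_mono_finite:
  assumes "A \<subseteq> C" "C \<subseteq> span E" "finite E"
  shows "dim A \<le> dim C"
proof -
  obtain b where b: "b \<subseteq> C" "independent b" "C \<subseteq> span b" "card b = dim C"
    by (rule basis_exists)
  have "finite b"
    using independent_span_bound[of E b] b assms by blast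
  then show ?thesis
    using dim_le_card[of A b] b assms by auto
qed

text \<open>
  In the application \<open>X n\<close> is the operator of \<open>L\<^sub>n\<close> and \<open>D m\<close> is the commutator with it. Take \<open>N\<close>
  such that the span of \<open>X N, X (N + 1), \<dots>\<close> has minimal dimension. If \<open>X n \<noteq> 0\<close> for some \<open>n \<ge> N\<close>,
  complete it to a basis of the span of the tail from \<open>n\<close> on. The map \<open>D n\<close> sends this span onto one
  that contains the tail from \<open>2 n + 1\<close> on, but it kills a basis vector, so that the dimension would
  drop.
\<close>

lemma eventually_zero_if_shifted:
  fixes X :: "nat \<Rightarrow> 'b" and D :: "nat \<Rightarrow> 'b \<Rightarrow> 'b" and c :: "nat \<Rightarrow> nat \<Rightarrow> 'a"
  assumes fin: "finite E" "\<And>n. n > 0 \<Longrightarrow> X n \<in> span E"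
    and lin: "\<And>m. m > 0 \<Longrightarrow> Vector_Spaces.linear scale scale (D m)"
    and shift: "\<And>m n. m > 0 \<Longrightarrow> n > m \<Longrightarrow> D m (X n) = c m n *s X (m + n)"
    and kill: "\<And>m. m > 0 \<Longrightarrow> D m (X m) = 0"
    and nz: "\<And>m n. m > 0 \<Longrightarrow> n > m \<Longrightarrow> c m n \<noteq> 0"
  obtains N where "N > 0" "\<And>n. n \<ge> N \<Longrightarrow> X n = 0"
proof -
  define U where "U n = X ` {n..}" for n
  have UE: "U n \<subseteq> span E" if "n > 0" for n
    using that fin(2) by (auto simp: U_def)
  obtain N where N: "N > 0" "\<And>M. M > 0 \<Longrightarrow> dim (U N) \<le> dim (U M)"
    using ex_has_least_nat[of "\<lambda>n. n > 0" 1 "\<lambda>n. dim (U n)"] by auto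
  have "X n = 0" if "n \<ge> N" for n
  proof (rule ccontr)
    assume "X n \<noteq> 0"
    have n: "n > 0" using that N by simp
    have "{X n} \<subseteq> span (U n)" by (auto simp: U_def intro: span_base)
    moreover have "independent {X n}" using \<open>X n \<noteq> 0\<close> by simp
    ultimately obtain e where e: "{X n} \<subseteq> e" "e \<subseteq> span (U n)" "independent e" "span (U n) \<subseteq> span e"
      by (rule maximal_independent_subset_extend)
    have "e \<subseteq> span E" using e(2) UE[OF n] span_minimal[of "U n" "span E"] by auto
    then have fe: "finite e" using independent_span_bound[OF fin(1) e(3)] by blast
    have ce: "card e = dim (U n)" using basis_card_eq_dim[OF e(2,4,3)] by simp
    interpret D: Vector_Spaces.linear scale scale "D n" by (rule lin[OF n])
    have "D n ` e \<subseteq> span (D n ` (e - {X n}))"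
    proof
      fix y assume "y \<in> D n ` e"
      then obtain x where "x \<in> e" "y = D n x" by blast
      then show "y \<in> span (D n ` (e - {X n}))"
        by (cases "x = X n") (auto simp: kill[OF n] span_zero intro: span_base)
    qed
    then have De: "span (D n ` e) \<subseteq> span (D n ` (e - {X n}))"
      by (rule span_minimal) simp
    (* From degree 2n + 1 on, an index is n + j with j > n, where the coefficient c n j is nonzero. *)
    have "U (2 * n + 1) \<subseteq> span (D n ` (e - {X n}))"
    proof
      fix y assume "y \<in> U (2 * n + 1)"
      then obtain k where k: "k \<ge> 2 * n + 1" "y = X k" by (auto simp: U_def)
      define j where "j = k - n"
      have j: "j > n" "k = n + j" using k by (auto simp: j_def)
      have "X j \<in> span (U n)" using j by (intro span_base) (auto simp: U_def)
      then have "X j \<in> span e" using e(4) by blast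
      then have "D n (X j) \<in> span (D n ` e)"
        using D.span_image[of e] by blast
      then have "c n j *s X k \<in> span (D n ` (e - {X n}))"
        using De shift[OF n j(1)] j(2) by auto
      then have "inverse (c n j) *s (c n j *s X k) \<in> span (D n ` (e - {X n}))"
        by (rule span_scale)
      then show "y \<in> span (D n ` (e - {X n}))"
        using nz[OF n j(1)] k(2) by simp
    qed
    then have "dim (U (2 * n + 1)) \<le> card (D n ` (e - {X n}))"
      by (rule dim_le_card) (use fe in simp)
    also have "\<dots> \<le> card (e - {X n})" using fe by (intro card_image_le) simp
    also have "\<dots> < card e" using fe e(1) by (intro psubset_card_mono) auto
    also have "\<dots> = dim (U n)" by (rule ce)
    also have "\<dots> \<le> dim (U N)"
      by (rule dim_mono_finite[OF _ UE[OF N(1)] fin(1)]) (use that in \<open>auto simp: U_def\<close>)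
    also have "\<dots> \<le> dim (U (2 * n + 1))" by (rule N(2)) simp
    finally show False by simp
  qed
  with N(1) show ?thesis using that by blast
qed

lemma poly_action_bound:
  fixes p :: "'a poly"
  assumes "degree p \<le> n"
  shows "poly_action scale T p v = (\<Sum>i\<le>n. coeff p i *s (T ^^ i) v)"
  unfolding poly_action_def using assms
  by (intro sum.mono_neutral_left) (auto simp: coeff_eq_0)

lemma poly_action_0 [simp]: "poly_action scale T 0 v = 0"
  by (simp add: poly_action_def)

lemma poly_action_pCons:
  assumes "Vector_Spaces.linear scale scale T"
  shows "poly_action scale T (pCons a p) v = a *s v + T (poly_action scale T p v)"
proof -
  interpret T: Vector_Spaces.linear scale scale T by fact
  have "poly_action scale T (pCons a p) v = (\<Sum>i\<le>Suc (degree p). coeff (pCons a p) i *s (T ^^ i) v)"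
    by (rule poly_action_bound) (rule degree_pCons_le)
  also have "\<dots> = a *s v + (\<Sum>i\<le>degree p. coeff p i *s T ((T ^^ i) v))"
    by (subst sum.atMost_Suc_shift) simp
  also have "\<dots> = a *s v + T (poly_action scale T p v)"
    by (simp add: poly_action_def T.sum T.scale)
  finally show ?thesis .
qed

lemma poly_action_add: "poly_action scale T (p + q) v = poly_action scale T p v + poly_action scale T q v"
proof -
  define n where "n = max (degree p) (degree q)"
  have "degree p \<le> n" "degree q \<le> n" "degree (p + q) \<le> n"
    by (auto simp: n_def degree_add_le_max)
  then show ?thesis
    by (simp add: poly_action_bound[of _ n] scale_left_distrib sum.distrib)
qed

lemma poly_action_smult: "poly_action scale T (smult a p) v = a *s poly_action scale T p v"
  by (simp add: poly_action_bound[of "smult a p" "degree p"] degree_smult_le poly_action_def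
      scale_sum_right)

lemma poly_action_in_subspace:
  assumes "Vector_Spaces.linear scale scale T" "subspace W" "T ` W \<subseteq> W" "v \<in> W"
  shows "poly_action scale T p v \<in> W"
  using assms
  by (induction p) (auto simp: poly_action_pCons subspace_0 intro!: subspace_add subspace_scale)

text \<open>
  The iterates \<open>T\<^sup>i v\<close> with \<open>i \<le> n\<close> are more vectors than the spanning set has, hence they satisfy
  a linear relation, whose coefficients are those of the polynomial.
\<close>

lemma annihilating_poly_exists:
  assumes fin: "finite E" "\<And>i. (T ^^ i) v \<in> span E"
  shows "\<exists>p. p \<noteq> 0 \<and> poly_action scale T p v = 0"
proof -
  define Y where "Y i = (T ^^ i) v" for i
  define n where "n = card E"
  have YE: "Y ` {..n} \<subseteq> span E" using fin by (auto simp: Y_def)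
  have "\<exists>c. (\<exists>i\<le>n. c i \<noteq> 0) \<and> (\<Sum>i\<le>n. c i *s Y i) = 0"
  proof (cases "inj_on Y {..n}")
    case True
    then have "card (Y ` {..n}) = Suc n" by (simp add: card_image)
    then have "dependent (Y ` {..n})"
      using independent_span_bound[OF fin(1) _ YE] by (auto simp: n_def)
    then obtain u where u: "\<exists>y\<in>Y ` {..n}. u y \<noteq> 0" "(\<Sum>y\<in>Y ` {..n}. u y *s y) = 0"
      by (auto simp: dependent_finite)
    then show ?thesis
      by (intro exI[of _ "\<lambda>i. u (Y i)"]) (auto simp: sum.reindex[OF True])
  next
    case False
    then obtain i j where ij: "i \<le> n" "j \<le> n" "i \<noteq> j" "Y i = Y j" by (auto simp: inj_on_def)
    (* A repetition among the iterates is itself a relation. *)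
    define c :: "nat \<Rightarrow> 'a" where "c = (\<lambda>k. (if k = i then 1 else 0) - (if k = j then 1 else 0))"
    have "(\<Sum>k\<le>n. c k *s Y k) = (\<Sum>k\<le>n. (if k = i then Y i else 0) - (if k = j then Y j else 0))"
      by (intro sum.cong) (auto simp: c_def ij)
    also have "\<dots> = 0" using ij by (simp add: sum_subtractf)
    finally show ?thesis using ij by (intro exI[of _ c]) (auto simp: c_def)
  qed
  then obtain c i where c: "i \<le> n" "c i \<noteq> 0" "(\<Sum>i\<le>n. c i *s Y i) = 0" by blast
  define p where "p = (\<Sum>i\<le>n. monom (c i) i)"
  have coeff: "coeff p k = (if k \<le> n then c k else 0)" for k
    by (simp add: p_def coeff_sum)
  have "p \<noteq> 0" using c coeff[of i] by auto
  moreover have "degree p \<le> n" by (rule degree_le) (simp add: coeff)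
  then have "poly_action scale T p v = 0"
    using c by (simp add: poly_action_bound[of p n] coeff Y_def)
  ultimately show ?thesis by blast
qed

end

text \<open>
  When \<open>[A, T]\<close> is a scalar \<open>l\<close>, commuting with \<open>A\<close> acts as the derivation \<open>l d/dT\<close> on polynomials
  in \<open>T\<close>.
\<close>

lemma (in vector_space) commutator_poly_action:
  assumes lin: "Vector_Spaces.linear scale scale A" "Vector_Spaces.linear scale scale T"
    and W: "subspace W" "T ` W \<subseteq> W" "A ` W \<subseteq> W"
    and comm: "\<And>v. v \<in> W \<Longrightarrow> A (T v) = T (A v) + l *s v" and v: "v \<in> W"
  shows "A (poly_action scale T p v) = poly_action scale T p (A v) + l *s poly_action scale T (pderiv p) v"
proof -
  interpret A: Vector_Spaces.linear scale scale A by fact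
  interpret T: Vector_Spaces.linear scale scale T by fact
  show ?thesis
  proof (induction p)
    case (pCons a p)
    have "poly_action scale T p v \<in> W" by (rule poly_action_in_subspace) (use lin W v in auto)
    then have "A (poly_action scale T (pCons a p) v) =
        a *s A v + (T (A (poly_action scale T p v)) + l *s poly_action scale T p v)"
      by (simp add: poly_action_pCons lin A.add A.scale comm)
    then show ?case
      by (simp add: pCons poly_action_pCons lin pderiv_pCons poly_action_add
          T.add T.scale algebra_simps)
  qed (simp add: A.zero)
qed

text \<open>
  Split a linear factor \<open>x - a\<close> off a polynomial \<open>p\<close> that annihilates \<open>v \<noteq> 0\<close>. The remaining factor
  \<open>q\<close> either yields the eigenvector \<open>q(T) v\<close>, or it annihilates \<open>v\<close> and has lower degree.
\<close>

lemma eigenvector_exists: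
  fixes scale :: "complex \<Rightarrow> 'v::ab_group_add \<Rightarrow> 'v"
  assumes "vector_space scale" and lin: "Vector_Spaces.linear scale scale T"
    and W: "module.span scale E = W" "finite E" "T ` W \<subseteq> W" "W \<noteq> {0}"
  shows "\<exists>a. \<exists>v\<in>W. v \<noteq> 0 \<and> T v = scale a v"
proof -
  interpret vector_space scale by fact
  have sub: "subspace W" using W(1) by auto
  obtain v where v: "v \<in> W" "v \<noteq> 0" using W(4) subspace_0[OF sub] by blast
  have iter: "(T ^^ i) v \<in> span E" for i
    by (induction i) (use v W in auto)
  obtain p where "p \<noteq> 0" "poly_action scale T p v = 0"
    using annihilating_poly_exists[OF W(2) iter] by blast
  then show ?thesis
  proof (induction "degree p" arbitrary: p rule: less_induct)
    case less
    have "degree p \<noteq> 0"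
    proof
      assume "degree p = 0"
      then show False using less.prems v by (auto simp: poly_action_def elim!: degree_eq_zeroE)
    qed
    then obtain a where "poly p a = 0"
      using fundamental_theorem_of_algebra[of p] by (auto simp: constant_degree)
    then obtain q where q: "p = [:- a, 1:] * q" by (auto simp: poly_eq_0_iff_dvd)
    then have "q \<noteq> 0" using less.prems by auto
    have q': "p = smult (- a) q + pCons 0 q" using q by simp
    have "poly_action scale T p v = scale (- a) (poly_action scale T q v) + T (poly_action scale T q v)"
      unfolding q' by (simp only: poly_action_add poly_action_smult poly_action_pCons[OF lin]
          scale_zero_left add_0)
    then have "T (poly_action scale T q v) = scale a (poly_action scale T q v)"
      using less.prems(2) by simp
    moreover have "poly_action scale T q v \<in> W"
      by (rule poly_action_in_subspace) (use lin sub W v in auto)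
    moreover have "degree q < degree p"
      unfolding q using \<open>q \<noteq> 0\<close> by (subst degree_mult_eq) auto
    ultimately show ?case using less.hyps[of q] \<open>q \<noteq> 0\<close> by blast
  qed
qed

text \<open>
  The trace would give this at once, by \<open>tr [A, T] = 0\<close>. Polynomials do as well: let \<open>v\<close> be an
  eigenvector of \<open>A\<close>. If a nonconstant polynomial \<open>p\<close> in \<open>T\<close> annihilates \<open>v\<close>, then so does
  \<open>[A, p(T)] = l p'(T)\<close>. For \<open>l \<noteq> 0\<close> the degree can be lowered until a nonzero constant
  annihilates \<open>v\<close>.
\<close>

lemma scalar_commutator_zero:
  fixes scale :: "complex \<Rightarrow> 'v::ab_group_add \<Rightarrow> 'v"
  assumes "vector_space scale"
    and lin: "Vector_Spaces.linear scale scale A" "Vector_Spaces.linear scale scale T"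
    and W: "module.span scale E = W" "finite E" "T ` W \<subseteq> W" "A ` W \<subseteq> W" "W \<noteq> {0}"
    and comm: "\<And>v. v \<in> W \<Longrightarrow> A (T v) = T (A v) + scale l v"
  shows "l = 0"
proof (rule ccontr)
  assume "l \<noteq> 0"
  interpret vector_space scale by fact
  have sub: "subspace W" using W(1) by auto
  obtain a v where v: "v \<in> W" "v \<noteq> 0" "A v = scale a v"
    using eigenvector_exists[OF _ lin(1) W(1,2,4,5)] vector_space_axioms by blast
  have iter: "(T ^^ i) v \<in> span E" for i
    by (induction i) (use v W in auto)
  interpret T: Vector_Spaces.linear scale scale T by fact
  interpret A: Vector_Spaces.linear scale scale A by fact
  have hom: "poly_action scale T p (scale a v) = scale a (poly_action scale T p v)" for p
    by (induction p) (simp_all add: poly_action_pCons lin T.scale algebra_simps)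
  obtain p where "p \<noteq> 0" "poly_action scale T p v = 0"
    using annihilating_poly_exists[OF W(2) iter] by blast
  then show False
  proof (induction "degree p" arbitrary: p rule: less_induct)
    case less
    have deg: "degree p \<noteq> 0"
    proof
      assume "degree p = 0"
      then show False using less.prems v by (auto simp: poly_action_def elim!: degree_eq_zeroE)
    qed
    have "scale l (poly_action scale T (pderiv p) v) = 0"
      using commutator_poly_action[OF lin sub W(3,4) comm v(1), where p = p] less.prems v
      by (simp add: hom A.zero)
    then have "poly_action scale T (pderiv p) v = 0" using \<open>l \<noteq> 0\<close> by simp
    moreover have "degree (pderiv p) < degree p" using deg by (simp add: degree_pderiv)
    moreover have "pderiv p \<noteq> 0" using deg by (simp add: pderiv_eq_0_iff)
    ultimately show ?case using less.hyps by blast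
  qed
qed

definition fun_scale :: "(complex \<Rightarrow> 'v \<Rightarrow> 'v) \<Rightarrow> complex \<Rightarrow> ('v \<Rightarrow> 'v) \<Rightarrow> 'v \<Rightarrow> 'v" where
  "fun_scale scale a f = (\<lambda>v. scale a (f v))"

lemma vector_space_fun_scale:
  "vector_space scale \<Longrightarrow> vector_space (fun_scale (scale :: complex \<Rightarrow> 'v::ab_group_add \<Rightarrow> 'v))"
  unfolding vector_space_def fun_scale_def by (simp add: fun_eq_iff)

lemma sum_fun_apply: "sum f I x = (\<Sum>i\<in>I. f i x)" for f :: "'i \<Rightarrow> 'x \<Rightarrow> 'v::ab_group_add"
  by (induction I rule: infinite_finite_induct) auto

text \<open>
  The endomorphisms of a finite-dimensional subspace \<open>W\<close> form a finite-dimensional space, as the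
  matrix units span it. An endomorphism of \<open>W\<close> says nothing about the rest of the ambient space, so
  it is turned into a function on all of it by composition with a map \<open>P\<close> into \<open>W\<close>.
\<close>

lemma operators_finitely_spanned:
  fixes scale :: "complex \<Rightarrow> 'v::ab_group_add \<Rightarrow> 'v"
  assumes "vector_space scale" and W: "module.span scale E = W" "finite E"
    and P: "\<And>v. P v \<in> W"
  shows "\<exists>F. finite F \<and> (\<lambda>f v. f (P v)) ` {f. (\<forall>v\<in>W. f v \<in> W) \<and>
      (\<forall>v\<in>W. \<forall>w\<in>W. f (v + w) = f v + f w) \<and> (\<forall>a. \<forall>v\<in>W. f (scale a v) = scale a (f v))}
    \<subseteq> module.span (fun_scale scale) F"
proof -
  interpret vector_space scale by fact
  interpret fs: vector_space "fun_scale scale" by (rule vector_space_fun_scale) fact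
  have sub: "subspace W" using W(1) by auto
  obtain B where B: "B \<subseteq> W" "independent B" "W \<subseteq> span B"
    by (rule basis_exists)
  have finB: "finite B" using independent_span_bound[OF W(2) B(2)] B(1) W(1) by blast
  have expand: "v = (\<Sum>b\<in>B. scale (representation B v b) b)" if "v \<in> W" for v
    using sum_representation_eq[OF B(2), of v B] finB B(3) that by auto
  define F where "F = (\<lambda>(b, c) v. scale (representation B (P v) b) c) ` (B \<times> B)"
  have "(\<lambda>v. f (P v)) \<in> fs.span F"
    if f: "\<And>v. v \<in> W \<Longrightarrow> f v \<in> W" "\<And>v w. v \<in> W \<Longrightarrow> w \<in> W \<Longrightarrow> f (v + w) = f v + f w"
      "\<And>a v. v \<in> W \<Longrightarrow> f (scale a v) = scale a (f v)" for f
  proof -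
    have f0: "f 0 = 0" using f(3)[of 0 0] subspace_0[OF sub] by simp
    have fsum: "f (\<Sum>b\<in>I. scale (r b) b) = (\<Sum>b\<in>I. scale (r b) (f b))" if "I \<subseteq> B" for I r
      using finite_subset[OF that finB] that
    proof (induction I rule: finite_induct)
      case (insert b I)
      then have "b \<in> W" "\<And>x. x \<in> I \<Longrightarrow> x \<in> W" using B(1) by auto
      then show ?case using insert f
        by (simp add: subspace_scale[OF sub] subspace_sum[OF sub])
    qed (simp add: f0)
    have "(\<lambda>v. f (P v)) =
        (\<Sum>b\<in>B. \<Sum>c\<in>B. fun_scale scale (representation B (f b) c)
            (\<lambda>v. scale (representation B (P v) b) c))"
    proof
      fix v
      have "f (P v) = (\<Sum>b\<in>B. scale (representation B (P v) b) (f b))"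
        by (rule trans[OF arg_cong[where f = f, OF expand[OF P]] fsum[OF order_refl]])
      also have "\<dots> = (\<Sum>b\<in>B. scale (representation B (P v) b)
          (\<Sum>c\<in>B. scale (representation B (f b) c) c))"
        by (intro sum.cong refl arg_cong[where f = "scale _"] expand f(1)) (use B(1) in auto)
      finally show "f (P v) = (\<Sum>b\<in>B. \<Sum>c\<in>B. fun_scale scale (representation B (f b) c)
            (\<lambda>v. scale (representation B (P v) b) c)) v"
        by (simp add: sum_fun_apply fun_scale_def scale_sum_right mult.commute)
    qed
    also have "\<dots> \<in> fs.span F"
      by (intro fs.span_sum fs.span_scale fs.span_base) (auto simp: F_def)
    finally show ?thesis .
  qed
  then have "(\<lambda>f v. f (P v)) ` {f. (\<forall>v\<in>W. f v \<in> W) \<and>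
      (\<forall>v\<in>W. \<forall>w\<in>W. f (v + w) = f v + f w) \<and> (\<forall>a. \<forall>v\<in>W. f (scale a v) = scale a (f v))}
    \<subseteq> fs.span F"
    by (intro image_subsetI) simp
  moreover have "finite F" using finB by (simp add: F_def)
  ultimately show ?thesis by (intro exI[of _ F] conjI)
qed

section \<open>Finite-dimensional simple modules\<close>

lemma downward_int_induct [consumes 1, case_names high step]:
  fixes n a N :: int
  assumes "n \<ge> a" "\<And>n. n \<ge> N \<Longrightarrow> Q n" "\<And>n. n \<ge> a \<Longrightarrow> (\<And>m. m > n \<Longrightarrow> Q m) \<Longrightarrow> Q n"
  shows "Q n"
  using assms(1)
proof (induction "nat (N - n)" arbitrary: n rule: less_induct)
  case less
  show ?case
  proof (rule assms(3)[OF less.prems])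
    fix m assume "m > n"
    then show "Q m"
      using less.hyps[of m] less.prems assms(2)[of m] by (cases "m \<ge> N") auto
  qed
qed

locale fin_simple_module =
  fixes \<epsilon> :: real and V :: "(qvec, 'v::ab_group_add) supermodule"
  assumes eps: "\<epsilon> \<in> {0, 1/2}"
    and simple: "is_simple_supermodule (qq_pos \<epsilon>) V"
    and fin: "finite_dim V"
begin

abbreviation "\<gg> \<equiv> qq_pos \<epsilon>"
abbreviation "X \<equiv> underlying V"
abbreviation "I \<equiv> qindices_pos \<epsilon>"
abbreviation scl (infixr "\<cdot>" 75) where "c \<cdot> v \<equiv> smul V c v"
abbreviation "opr a \<equiv> act V (qbasis a)"

lemma module: "is_supermodule \<gg> V"
  using simple by (simp add: is_simple_supermodule_def)

lemma superspace: "is_superspace V"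
  using module by (simp add: is_supermodule_def)

sublocale vs: vector_space "smul V"
  using superspace by (simp add: is_superspace_def)

lemma part_subspace: "vs.subspace (part V i)"
  using superspace by (simp add: is_superspace_def)

lemma bit_cases_shift: "(j::bit) = i \<or> j = i + 1"
  by (cases i; cases j) auto

lemma part_inter:
  assumes "v \<in> part V i" "v \<in> part V (i + 1)" shows "v = 0"
  using assms superspace by (cases i) (auto simp: is_superspace_def)

lemma X_subspace: "vs.subspace X"
  unfolding underlying_def using vs.subspace_sums[OF part_subspace part_subspace] by simp

lemma part_X: "v \<in> part V i \<Longrightarrow> v \<in> X"
proof (cases i)
  assume "v \<in> part V i" "i = 0"
  then have "v \<in> part V 0 \<and> v = v + 0 \<and> 0 \<in> part V 1"
    using vs.subspace_0[OF part_subspace] by simp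
  then show ?thesis unfolding underlying_def by blast
next
  assume "v \<in> part V i" "i = 1"
  then have "v \<in> part V 1 \<and> v = 0 + v \<and> 0 \<in> part V 0"
    using vs.subspace_0[OF part_subspace] by simp
  then show ?thesis unfolding underlying_def by blast
qed

lemma X_decompose:
  assumes "v \<in> X" obtains a b where "a \<in> part V 0" "b \<in> part V 1" "v = a + b"
  using assms unfolding underlying_def by blast

lemma X_nontrivial: "X \<noteq> {0}"
  using simple by (simp add: is_simple_supermodule_def)

lemma submodule_cases: "is_subsupermodule \<gg> V W \<Longrightarrow> W = {0} \<or> W = X"
  using simple by (simp add: is_simple_supermodule_def)

lemma smul_gg: "smul \<gg> = qscale" and brk_gg: "brk \<gg> = qbrk"
  by (simp_all add: qq_pos_def qq_def)

lemma underlying_gg: "underlying \<gg> = {x. Poly_Mapping.keys x \<subseteq> I}"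
  using underlying_qq_pos[OF eps] by (simp add: span_qbasis)

lemma basis_part: "a \<in> I \<Longrightarrow> qbasis a \<in> part \<gg> (parity a)"
  by (simp add: part_qq_pos[OF eps] span_part_def)

lemma basis_gg: "a \<in> I \<Longrightarrow> qbasis a \<in> underlying \<gg>"
  by (simp add: underlying_gg)

lemma act_X: "x \<in> underlying \<gg> \<Longrightarrow> v \<in> X \<Longrightarrow> act V x v \<in> X"
  and act_add: "x \<in> underlying \<gg> \<Longrightarrow> v \<in> X \<Longrightarrow> w \<in> X \<Longrightarrow> act V x (v + w) = act V x v + act V x w"
  and act_scale: "x \<in> underlying \<gg> \<Longrightarrow> v \<in> X \<Longrightarrow> act V x (c \<cdot> v) = c \<cdot> act V x v"
  using module by (simp_all add: is_supermodule_def linear_between_def)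

lemma act_add_left: "x \<in> underlying \<gg> \<Longrightarrow> y \<in> underlying \<gg> \<Longrightarrow> v \<in> X \<Longrightarrow>
    act V (x + y) v = act V x v + act V y v"
  and act_scale_left: "x \<in> underlying \<gg> \<Longrightarrow> v \<in> X \<Longrightarrow> act V (qscale c x) v = c \<cdot> act V x v"
  using module by (simp_all add: is_supermodule_def linear_between_def smul_gg)

lemma act_part: "x \<in> part \<gg> i \<Longrightarrow> v \<in> part V j \<Longrightarrow> act V x v \<in> part V (i + j)"
  using module by (simp add: is_supermodule_def)

lemma act_bracket: "x \<in> part \<gg> i \<Longrightarrow> y \<in> part \<gg> j \<Longrightarrow> v \<in> X \<Longrightarrow>
    act V (qbrk x y) v = act V x (act V y v) - koszul i j \<cdot> act V y (act V x v)"
  using module by (simp add: is_supermodule_def brk_gg)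

lemma act_zero_left: "v \<in> X \<Longrightarrow> act V 0 v = 0"
  using act_scale_left[of 0 v 0] by (simp add: underlying_gg)

lemmas opr_X = act_X[OF basis_gg] and opr_add = act_add[OF basis_gg]
  and opr_scale = act_scale[OF basis_gg] and opr_part = act_part[OF basis_part]

lemma opr_zero: "a \<in> I \<Longrightarrow> opr a 0 = 0"
  using opr_scale[of a 0 0] vs.subspace_0[OF X_subspace] by simp

lemma bracket: "a \<in> I \<Longrightarrow> b \<in> I \<Longrightarrow> v \<in> X \<Longrightarrow>
    opr a (opr b v) = act V (bbrk a b) v + koszul (parity a) (parity b) \<cdot> opr b (opr a v)"
  using act_bracket[OF basis_part basis_part, of a b v] by (simp add: qbrk_basis)

text \<open>
  The elements that send a fixed \<open>w\<close> into the subspace \<open>W\<close> form a subspace themselves, so it is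
  enough to look at the basis.
\<close>

lemma invariant_under_basis:
  assumes W: "vs.subspace W" "W \<subseteq> X" and inv: "\<And>a. a \<in> I \<Longrightarrow> opr a w \<in> W"
    and w: "w \<in> W" and x: "x \<in> underlying \<gg>"
  shows "act V x w \<in> W"
proof -
  have "w \<in> X" using w W by blast
  have "Poly_Mapping.keys x \<subseteq> I" using x by (simp add: underlying_gg)
  then have "x \<in> underlying \<gg> \<and> act V x w \<in> W"
  proof (induction x rule: qvec_induct)
    case zero
    then show ?case using \<open>w \<in> X\<close> vs.subspace_0[OF W(1)] by (simp add: act_zero_left underlying_gg)
  next
    case (add x y)
    then show ?case using \<open>w \<in> X\<close> vs.subspace_add[OF W(1)]
      by (simp add: act_add_left underlying_gg keys_subsetI)
  next
    case (scale c x)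
    then show ?case using \<open>w \<in> X\<close> vs.subspace_scale[OF W(1)]
      by (simp add: act_scale_left underlying_gg keys_subsetI)
  next
    case (basis a)
    then show ?case using inv by (simp add: basis_gg)
  qed
  then show ?thesis by simp
qed

subsection \<open>Schur's lemma\<close>

text \<open>
  Schur's lemma: the kernel of a homogeneous map (of parity \<open>j\<close>) is graded, and if the action
  preserves it, it is a submodule, hence everything as soon as it is nonzero. Invariance of
  the kernel is weaker than commuting with the action, and so covers maps that
  commute with it only up to sign.
\<close>

lemma homogeneous_kernel:
  assumes add: "\<And>v w. v \<in> X \<Longrightarrow> w \<in> X \<Longrightarrow> T (v + w) = T v + T w"
    and scale: "\<And>c v. v \<in> X \<Longrightarrow> T (c \<cdot> v) = c \<cdot> T v"
    and hom: "\<And>v i. v \<in> part V i \<Longrightarrow> T v \<in> part V (i + j)"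
    and inv: "\<And>a v. a \<in> I \<Longrightarrow> v \<in> X \<Longrightarrow> T v = 0 \<Longrightarrow> T (opr a v) = 0"
    and w: "w \<in> X" "w \<noteq> 0" "T w = 0" and v: "v \<in> X"
  shows "T v = 0"
proof -
  define W where "W = {v \<in> X. T v = 0}"
  have "T 0 = 0" using scale[OF w(1), of 0] by simp
  then have sub: "vs.subspace W" unfolding W_def
    by (intro vs.subspaceI) (auto simp: add scale vs.subspace_0[OF X_subspace]
        vs.subspace_add[OF X_subspace] vs.subspace_scale[OF X_subspace])
  have graded: "\<exists>a\<in>W \<inter> part V 0. \<exists>b\<in>W \<inter> part V 1. u = a + b" if "u \<in> W" for u
  proof -
    obtain a b where ab: "a \<in> part V 0" "b \<in> part V 1" "u = a + b"
      using \<open>u \<in> W\<close> X_decompose unfolding W_def by blast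
    have ab': "a \<in> X" "b \<in> X" using ab part_X by auto
    have "T a + T b = 0" using \<open>u \<in> W\<close> add[OF ab'] by (simp add: W_def ab)
    then have eq: "T a = - T b" by (simp add: eq_neg_iff_add_eq_0)
    have "T a \<in> part V j" using hom[OF ab(1)] by (simp only: add_0)
    moreover have "T a \<in> part V (j + 1)"
      unfolding eq using vs.subspace_neg[OF part_subspace hom[OF ab(2)]] by (simp add: add.commute)
    ultimately have "T a = 0" by (rule part_inter)
    then have "T b = 0" using eq by simp
    then show ?thesis using ab ab' \<open>T a = 0\<close> unfolding W_def by blast
  qed
  have WX: "W \<subseteq> X" by (auto simp: W_def)
  have inv': "opr a u \<in> W" if "u \<in> W" "a \<in> I" for a u
    using that inv opr_X by (auto simp: W_def)
  have "is_subsupermodule \<gg> V W"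
    unfolding is_subsupermodule_def
    using sub WX graded invariant_under_basis[OF sub WX inv'] by blast
  then have "W = X" using submodule_cases w by (auto simp: W_def)
  then show ?thesis using v by (auto simp: W_def)
qed

text \<open>
  The action is linear on \<open>X\<close> only. The operators \<open>hat a\<close> below extend it through a projection onto
  \<open>X\<close> to linear maps on the ambient space, to which the preceding section applies.
\<close>

definition proj :: "'v \<Rightarrow> 'v" where
  "proj = (SOME P. P ` UNIV \<subseteq> X \<and> Vector_Spaces.linear (smul V) (smul V) P \<and> (\<forall>v\<in>X. P v = v))"

lemma proj: "proj v \<in> X" "Vector_Spaces.linear (smul V) (smul V) proj" "v \<in> X \<Longrightarrow> proj v = v"
proof -
  interpret vector_space_pair "smul V" "smul V" ..
  have "\<exists>P. P ` UNIV \<subseteq> X \<and> Vector_Spaces.linear (smul V) (smul V) P \<and> (\<forall>v\<in>X. P (id v) = v)"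
    by (rule linear_exists_left_inverse_on) (use vs.linear_id X_subspace in \<open>auto simp: id_def\<close>)
  then have "proj ` UNIV \<subseteq> X \<and> Vector_Spaces.linear (smul V) (smul V) proj \<and> (\<forall>v\<in>X. proj v = v)"
    unfolding proj_def by (intro someI_ex[where P = "\<lambda>P. P ` UNIV \<subseteq> X \<and> _ P \<and> _ P"]) simp
  then show "proj v \<in> X" "Vector_Spaces.linear (smul V) (smul V) proj" "v \<in> X \<Longrightarrow> proj v = v"
    by auto
qed

definition "hat a v = opr a (proj v)"

lemma hat_linear: "a \<in> I \<Longrightarrow> Vector_Spaces.linear (smul V) (smul V) (hat a)"
proof -
  assume "a \<in> I"
  interpret P: Vector_Spaces.linear "smul V" "smul V" proj by (rule proj)
  show ?thesis
    by unfold_locales (simp_all add: hat_def P.add P.scale opr_add opr_scale \<open>a \<in> I\<close> proj(1))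
qed

lemma hat_eq: "v \<in> X \<Longrightarrow> hat a v = opr a v"
  by (simp add: hat_def proj(3))

lemma hat_X: "a \<in> I \<Longrightarrow> hat a v \<in> X"
  by (simp add: hat_def opr_X proj(1))

lemma spanning_set: obtains E where "finite E" "vs.span E = X"
  using fin by (auto simp: finite_dim_def)

text \<open>
  On the eigenspace of an eigenvalue \<open>l\<close> the map \<open>opr a - l\<close> vanishes, so Schur's lemma applies to it.
\<close>

lemma central_even_scalar:
  assumes a: "a \<in> I" "parity a = 0"
    and central: "\<And>b v. b \<in> I \<Longrightarrow> v \<in> X \<Longrightarrow> opr a (opr b v) = opr b (opr a v)"
  shows "\<exists>l. \<forall>v\<in>X. opr a v = l \<cdot> v"
proof -
  obtain E where E: "finite E" "vs.span E = X" by (rule spanning_set)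
  have "hat a ` X \<subseteq> X" using hat_X[OF a(1)] by auto
  then obtain l w where w: "w \<in> X" "w \<noteq> 0" "hat a w = l \<cdot> w"
    using eigenvector_exists[OF vs.vector_space_axioms hat_linear[OF a(1)] E(2,1) _ X_nontrivial]
    by blast
  have "opr a v - l \<cdot> v = 0" if "v \<in> X" for v
  proof (rule homogeneous_kernel[where T = "\<lambda>v. opr a v - l \<cdot> v" and j = 0 and w = w])
    fix b v assume *: "b \<in> I" "v \<in> X" "opr a v - l \<cdot> v = 0"
    then have "opr a v = l \<cdot> v" by simp
    then show "opr a (opr b v) - l \<cdot> opr b v = 0"
      using * central opr_scale by simp
  next
    fix v i assume "v \<in> part V i"
    then show "opr a v - l \<cdot> v \<in> part V (i + 0)"
      using opr_part[OF a(1), of v i] a(2)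
      by (auto intro!: vs.subspace_diff vs.subspace_scale part_subspace)
  qed (use w that a in \<open>auto simp: opr_add opr_scale hat_eq algebra_simps\<close>)
  then show ?thesis by auto
qed

text \<open>
  Commuting with itself up to the sign \<open>- 1\<close>, the operator squares to \<open>0\<close>. Hence it kills a nonzero
  vector: either a given nonzero \<open>u\<close> or its image.
\<close>

lemma central_odd_zero:
  assumes a: "a \<in> I" "parity a = 1"
    and comm: "\<And>b v. b \<in> I \<Longrightarrow> v \<in> X \<Longrightarrow>
      opr a (opr b v) = koszul 1 (parity b) \<cdot> opr b (opr a v)"
    and v: "v \<in> X"
  shows "opr a v = 0"
proof -
  have sq: "opr a (opr a u) = 0" if "u \<in> X" for u
  proof -
    have "opr a (opr a u) = - opr a (opr a u)" using comm[OF a(1) that] a(2) by simp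
    then have "2 \<cdot> opr a (opr a u) = 0"
      using vs.scale_left_distrib[of 1 1 "opr a (opr a u)"] by (simp add: eq_neg_iff_add_eq_0)
    then show ?thesis by simp
  qed
  obtain w where w: "w \<in> X" "w \<noteq> 0" "opr a w = 0"
  proof -
    obtain u where u: "u \<in> X" "u \<noteq> 0" using X_nontrivial vs.subspace_0[OF X_subspace] by blast
    show thesis
      using that[of u] that[of "opr a u"] u sq[OF u(1)] opr_X[OF a(1) u(1)] by blast
  qed
  show ?thesis
  proof (rule homogeneous_kernel[where T = "opr a" and j = 1 and w = w])
    fix b u assume "b \<in> I" "u \<in> X" "opr a u = 0"
    then show "opr a (opr b u) = 0" using comm by (simp add: opr_zero)
  next
    fix u i assume "u \<in> part V i"
    then show "opr a u \<in> part V (i + 1)"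
      using opr_part[OF a(1), of u i] a(2) by (simp add: add.commute)
  qed (use w a v in \<open>auto simp: opr_add opr_scale\<close>)
qed

lemma central_commutator_zero:
  assumes a: "a \<in> I" "parity a = 0" and bc: "b \<in> I" "c \<in> I"
    and central: "\<And>b v. b \<in> I \<Longrightarrow> v \<in> X \<Longrightarrow> opr a (opr b v) = opr b (opr a v)"
    and comm: "\<And>v. v \<in> X \<Longrightarrow> opr b (opr c v) = opr c (opr b v) + k \<cdot> opr a v" and k: "k \<noteq> 0"
    and v: "v \<in> X"
  shows "opr a v = 0"
proof -
  obtain l where l: "\<And>v. v \<in> X \<Longrightarrow> opr a v = l \<cdot> v"
    using central_even_scalar[OF a central] by blast
  obtain E where E: "finite E" "vs.span E = X" by (rule spanning_set)
  have "k * l = 0"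
  proof (rule scalar_commutator_zero[OF vs.vector_space_axioms hat_linear[OF bc(1)] hat_linear[OF bc(2)] E(2,1)])
    fix v assume "v \<in> X"
    then show "hat b (hat c v) = hat c (hat b v) + (k * l) \<cdot> v"
      using comm[of v] l[of v] by (simp add: hat_eq opr_X bc)
  qed (use hat_X bc X_nontrivial in auto)
  then show ?thesis using k l v by simp
qed

subsection \<open>Commutation relations\<close>

lemma relations:
  assumes "v \<in> X"
  shows
    "m > 0 \<Longrightarrow> n > 0 \<Longrightarrow> opr (Lx m) (opr (Lx n) v) =
       opr (Lx n) (opr (Lx m) v) + of_int (n - m) \<cdot> opr (Lx (m + n)) v"
    "m > 0 \<Longrightarrow> n > 0 \<Longrightarrow> opr (Lx m) (opr (Hx n) v) =
       opr (Hx n) (opr (Lx m) v) + of_int n \<cdot> opr (Hx (m + n)) v"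
    "m > 0 \<Longrightarrow> n > 0 \<Longrightarrow> opr (Hx m) (opr (Hx n) v) = opr (Hx n) (opr (Hx m) v)"
    "m > 0 \<Longrightarrow> Gx p \<in> I \<Longrightarrow> opr (Hx m) (opr (Gx p) v) =
       opr (Gx p) (opr (Hx m) v) + opr (Gx (p + of_int m)) v"
    "m > 0 \<Longrightarrow> Gx p \<in> I \<Longrightarrow> opr (Lx m) (opr (Gx p) v) =
       opr (Gx p) (opr (Lx m) v) + of_real (p - of_int m / 2) \<cdot> opr (Gx (p + of_int m)) v"
  using bracket[of "Lx m" "Lx n" v] bracket[of "Lx m" "Hx n" v] bracket[of "Hx m" "Hx n" v]
    bracket[of "Hx m" "Gx p" v] bracket[of "Lx m" "Gx p" v] assms
  by (simp_all add: qindices_pos_mem act_scale_left act_zero_left basis_gg qindices_pos_shift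
      add.commute del: of_int_diff of_real_diff)

lemma qindices_pos_cases [consumes 1, case_names L H G]:
  assumes "a \<in> I"
  obtains m where "a = Lx m" "m > 0" | m where "a = Hx m" "m > 0"
    | k where "a = Gx (of_int k - \<epsilon>)" "k > 0"
  using assms unfolding qindices_pos_def by blast

lemma G_mem: "k > 0 \<Longrightarrow> Gx (of_int k - \<epsilon>) \<in> I"
  unfolding qindices_pos_def by blast

lemma relations_G:
  assumes "v \<in> X" "m > 0" "k > 0"
  shows "opr (Hx m) (opr (Gx (of_int k - \<epsilon>)) v) =
       opr (Gx (of_int k - \<epsilon>)) (opr (Hx m) v) + opr (Gx (of_int (k + m) - \<epsilon>)) v"
    "\<exists>c. opr (Lx m) (opr (Gx (of_int k - \<epsilon>)) v) =
       opr (Gx (of_int k - \<epsilon>)) (opr (Lx m) v) + c \<cdot> opr (Gx (of_int (k + m) - \<epsilon>)) v"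
proof -
  have eq: "of_int (k + m) - \<epsilon> = of_int k - \<epsilon> + of_int m" by simp
  show "opr (Hx m) (opr (Gx (of_int k - \<epsilon>)) v) =
       opr (Gx (of_int k - \<epsilon>)) (opr (Hx m) v) + opr (Gx (of_int (k + m) - \<epsilon>)) v"
    unfolding eq using assms by (intro relations(4) G_mem)
  show "\<exists>c. opr (Lx m) (opr (Gx (of_int k - \<epsilon>)) v) =
       opr (Gx (of_int k - \<epsilon>)) (opr (Lx m) v) + c \<cdot> opr (Gx (of_int (k + m) - \<epsilon>)) v"
    unfolding eq using relations(5)[OF assms(1,2) G_mem[OF assms(3)]] by blast
qed

subsection \<open>Vanishing in high degrees\<close>

text \<open>
  This is \<open>eventually_zero_if_shifted\<close> in the finite-dimensional space of operators; the shifts are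
  the commutators with the \<open>L\<^sub>m\<close>.
\<close>

lemma L_eventually_zero:
  obtains N :: int where "N > 0" "\<And>n v. n \<ge> N \<Longrightarrow> v \<in> X \<Longrightarrow> opr (Lx n) v = 0"
proof -
  obtain E where E: "finite E" "vs.span E = X" by (rule spanning_set)
  interpret fs: vector_space "fun_scale (smul V)"
    by (rule vector_space_fun_scale) (rule vs.vector_space_axioms)
  obtain F where "finite F \<and> (\<lambda>f v. f (proj v)) ` {f. (\<forall>v\<in>X. f v \<in> X) \<and>
      (\<forall>v\<in>X. \<forall>w\<in>X. f (v + w) = f v + f w) \<and> (\<forall>a. \<forall>v\<in>X. f (a \<cdot> v) = a \<cdot> f v)}
    \<subseteq> fs.span F"
    using operators_finitely_spanned[where P = proj, OF vs.vector_space_axioms E(2,1) proj(1)]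
    by (rule exE)
  then have F: "finite F" "(\<lambda>v. opr a (proj v)) \<in> fs.span F" if "a \<in> I" for a
    using that by (auto simp: image_subset_iff opr_X opr_add opr_scale)
  define Y where "Y n = hat (Lx (int n))" for n
  define D where "D m f = (\<lambda>v. Y m (f v) - f (Y m v))" for m f
  have mem: "Lx (int n) \<in> I" if "n > 0" for n using that by (simp add: qindices_pos_mem)
  obtain N where N: "N > 0" "\<And>n. n \<ge> N \<Longrightarrow> Y n = 0"
  proof (rule fs.eventually_zero_if_shifted[of F Y D "\<lambda>m n. of_int (int n - int m)"])
    show "finite F" by (rule F(1)[OF mem[of 1]]) simp
    show "Y n \<in> fs.span F" if "n > 0" for n
      using F(2)[OF mem[OF that]] by (simp add: Y_def hat_def[abs_def])
    show "Vector_Spaces.linear (fun_scale (smul V)) (fun_scale (smul V)) (D m)" if "m > 0" for m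
    proof -
      interpret Y: Vector_Spaces.linear "smul V" "smul V" "Y m"
        unfolding Y_def by (rule hat_linear[OF mem[OF that]])
      show ?thesis
        by unfold_locales
          (simp_all add: D_def fun_scale_def fun_eq_iff Y.add Y.scale vs.scale_right_diff_distrib)
    qed
    show "D m (Y n) = fun_scale (smul V) (of_int (int n - int m)) (Y (m + n))"
      if "m > 0" "n > m" for m n
    proof
      fix v
      have "opr (Lx (int m)) (opr (Lx (int n)) (proj v)) = opr (Lx (int n)) (opr (Lx (int m)) (proj v))
          + of_int (int n - int m) \<cdot> opr (Lx (int m + int n)) (proj v)"
        by (rule relations(1)) (use that proj(1) in auto)
      then show "D m (Y n) v = fun_scale (smul V) (of_int (int n - int m)) (Y (m + n)) v"
        using that by (simp add: D_def Y_def hat_def fun_scale_def proj opr_X mem)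
    qed
    show "D m (Y m) = 0" for m by (simp add: D_def fun_eq_iff)
    show "of_int (int n - int m) \<noteq> (0 :: complex)" if "m > 0" "n > m" for m n
      using that by (simp only: of_int_eq_0_iff)
  qed (use that in blast)
  have "opr (Lx n) v = 0" if "n \<ge> int N" "v \<in> X" for n v
  proof -
    have "Y (nat n) = 0" using that by (intro N(2)) auto
    then show ?thesis using that hat_eq[of v "Lx n"] by (simp add: Y_def fun_eq_iff)
  qed
  then show thesis using that[of "int N"] N(1) by simp
qed

text \<open>
  If \<open>L\<^sub>N\<close> acts as \<open>0\<close>, then so does \<open>[L\<^sub>N, H\<^sub>n\<^sub>-\<^sub>N] = (n - N) H\<^sub>n\<close>, and from one vanishing \<open>H\<^sub>m\<close>
  the same follows for \<open>[H\<^sub>m, G\<^sub>p] = G\<^sub>m\<^sub>+\<^sub>p\<close>.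
\<close>

lemma high_degree_zero:
  obtains N :: int where
    "\<And>n v. n \<ge> N \<Longrightarrow> v \<in> X \<Longrightarrow> opr (Lx n) v = 0"
    "\<And>n v. n \<ge> N \<Longrightarrow> v \<in> X \<Longrightarrow> opr (Hx n) v = 0"
    "\<And>k v. k \<ge> N \<Longrightarrow> v \<in> X \<Longrightarrow> opr (Gx (of_int k - \<epsilon>)) v = 0"
proof -
  obtain N :: int where N: "N > 0" "\<And>n v. n \<ge> N \<Longrightarrow> v \<in> X \<Longrightarrow> opr (Lx n) v = 0"
    by (rule L_eventually_zero) blast
  have H: "opr (Hx n) v = 0" if "n > N" "v \<in> X" for n v
  proof -
    have "Hx (n - N) \<in> I" using that by (simp add: qindices_pos_mem)
    then have "of_int (n - N) \<cdot> opr (Hx n) v = 0"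
      using relations(2)[of v N "n - N"] that N by (simp add: opr_X opr_zero del: of_int_diff)
    then show ?thesis using that by (simp del: of_int_diff)
  qed
  have "opr (Gx (of_int k - \<epsilon>)) v = 0" if "k > N + 1" "v \<in> X" for k v
    using relations_G(1)[of v "N + 1" "k - (N + 1)"] that N(1) G_mem[of "k - (N + 1)"]
    by (simp add: H opr_X opr_zero del: of_int_diff of_int_add)
  then show thesis using that[of "N + 2"] N(2) H by simp
qed

subsection \<open>Descent on the degree\<close>

text \<open>
  If all \<open>G\<close> of higher degree vanish, brackets with the even generators, which raise the degree,
  contribute nothing; the \<open>G\<close> anticommute among themselves in any case. So the operator is odd and
  central.
\<close>

lemma G_zero:
  assumes "k > 0" "v \<in> X" shows "opr (Gx (of_int k - \<epsilon>)) v = 0"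
proof -
  obtain N :: int where N: "\<And>k v. k \<ge> N \<Longrightarrow> v \<in> X \<Longrightarrow> opr (Gx (of_int k - \<epsilon>)) v = 0"
    by (rule high_degree_zero) blast
  have "k \<ge> 1" using assms by simp
  then have "\<forall>v\<in>X. opr (Gx (of_int k - \<epsilon>)) v = 0"
  proof (induction rule: downward_int_induct[where N = N])
    case (step k)
    have mem: "Gx (of_int k - \<epsilon>) \<in> I" using step by (simp add: G_mem)
    have comm: "opr (Gx (of_int k - \<epsilon>)) (opr b v) =
        koszul 1 (parity b) \<cdot> opr b (opr (Gx (of_int k - \<epsilon>)) v)"
      if "b \<in> I" "v \<in> X" for b v
      using \<open>b \<in> I\<close>
    proof (cases rule: qindices_pos_cases)
      case (L m)
      then have "opr (Gx (of_int (k + m) - \<epsilon>)) v = 0" using step that(2) by (simp del: of_int_add)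
      then show ?thesis
        using relations_G(2)[of v m k] L step that(2) by (auto simp del: of_int_add)
    next
      case (H m)
      then have "opr (Gx (of_int (k + m) - \<epsilon>)) v = 0" using step that(2) by (simp del: of_int_add)
      then show ?thesis
        using relations_G(1)[of v m k] H step that(2) by (auto simp del: of_int_add)
    next
      case (G j)
      then show ?thesis using bracket[OF mem that] that by (simp add: act_zero_left)
    qed
    show ?case using central_odd_zero[OF mem _ comm] by simp
  qed (use N in auto)
  then show ?thesis using assms by blast
qed

text \<open>
  The bound \<open>n \<ge> 2\<close> makes \<open>H\<^sub>n\<close> the commutator of \<open>L\<^sub>n\<^sub>-\<^sub>1\<close> and \<open>H\<^sub>1\<close>, both of positive degree. As the
  \<open>G\<close> already vanish, only brackets with the \<open>L\<^sub>m\<close> could obstruct centrality, and they lead to higher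
  degree.
\<close>

lemma H_zero:
  assumes "n \<ge> 2" "v \<in> X" shows "opr (Hx n) v = 0"
proof -
  obtain N :: int where N: "\<And>k v. k \<ge> N \<Longrightarrow> v \<in> X \<Longrightarrow> opr (Hx k) v = 0"
    by (rule high_degree_zero) blast
  have "\<forall>v\<in>X. opr (Hx n) v = 0"
    using assms(1)
  proof (induction rule: downward_int_induct[where N = N])
    case (step n)
    have mem: "Hx n \<in> I" "Lx (n - 1) \<in> I" "Hx 1 \<in> I" using step by (auto simp: qindices_pos_mem)
    have central: "opr (Hx n) (opr b v) = opr b (opr (Hx n) v)" if "b \<in> I" "v \<in> X" for b v
      using \<open>b \<in> I\<close>
    proof (cases rule: qindices_pos_cases)
      case (L m)
      then show ?thesis using relations(2)[of v m n] step that(2) by auto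
    next
      case (H m)
      then show ?thesis using relations(3)[of v m n] step that(2) by auto
    next
      case (G j)
      then show ?thesis using that mem by (simp add: G_zero opr_X opr_zero)
    qed
    have "opr (Lx (n - 1)) (opr (Hx 1) v) = opr (Hx 1) (opr (Lx (n - 1)) v) + 1 \<cdot> opr (Hx n) v"
      if "v \<in> X" for v
      using relations(2)[OF that, of "n - 1" 1] step by simp
    then show ?case using central_commutator_zero[OF mem(1) _ mem(2,3) central, of 1] by simp
  qed (use N in auto)
  then show ?thesis using assms by blast
qed

text \<open>
  Here \<open>n \<ge> 3\<close> is what is needed for \<open>(n - 2) L\<^sub>n = [L\<^sub>1, L\<^sub>n\<^sub>-\<^sub>1]\<close> to have a nonzero coefficient;
  \<open>L\<^sub>2\<close> is not a commutator and may act by any scalar. Centrality also uses \<open>[L\<^sub>n, H\<^sub>m] = m H\<^sub>n\<^sub>+\<^sub>m\<close>,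
  where the right-hand side is already known to vanish.
\<close>

lemma L_zero:
  assumes "n \<ge> 3" "v \<in> X" shows "opr (Lx n) v = 0"
proof -
  obtain N :: int where N: "\<And>k v. k \<ge> N \<Longrightarrow> v \<in> X \<Longrightarrow> opr (Lx k) v = 0"
    by (rule high_degree_zero) blast
  have "\<forall>v\<in>X. opr (Lx n) v = 0"
    using assms(1)
  proof (induction rule: downward_int_induct[where N = N])
    case (step n)
    have mem: "Lx n \<in> I" "Lx 1 \<in> I" "Lx (n - 1) \<in> I" using step by (auto simp: qindices_pos_mem)
    have central: "opr (Lx n) (opr b v) = opr b (opr (Lx n) v)" if "b \<in> I" "v \<in> X" for b v
      using \<open>b \<in> I\<close>
    proof (cases rule: qindices_pos_cases)
      case (L m)
      then show ?thesis using relations(1)[of v m n] step that(2) by auto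
    next
      case (H m)
      then show ?thesis using relations(2)[of v n m] step that(2) H_zero[of "n + m" v] by auto
    next
      case (G j)
      then show ?thesis using that mem by (simp add: G_zero opr_X opr_zero)
    qed
    have comm: "opr (Lx 1) (opr (Lx (n - 1)) v) =
        opr (Lx (n - 1)) (opr (Lx 1) v) + of_int (n - 2) \<cdot> opr (Lx n) v"
      if "v \<in> X" for v
      using relations(1)[OF that, of 1 "n - 1"] step by simp
    have "(of_int (n - 2) :: complex) \<noteq> 0" using step by (simp only: of_int_eq_0_iff)
    then show ?case
      by (intro ballI central_commutator_zero[OF mem(1) _ mem(2,3) central comm]) simp_all
  qed (use N in auto)
  then show ?thesis using assms by blast
qed

text \<open>
  A bracket of two even generators lies in degree at least \<open>2\<close>, or at least \<open>3\<close> for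
  distinct \<open>L\<close>, where the operators have been shown to vanish.
\<close>

lemma opr_commute:
  assumes "a \<in> I" "b \<in> I" "v \<in> X" shows "opr a (opr b v) = opr b (opr a v)"
proof -
  have LH: "opr (Lx m) (opr (Hx n) v) = opr (Hx n) (opr (Lx m) v)" if "m > 0" "n > 0" for m n
    using relations(2)[of v m n] H_zero[of "m + n" v] that assms(3) by simp
  have LL: "opr (Lx m) (opr (Lx n) v) = opr (Lx n) (opr (Lx m) v)" if "m > 0" "n > 0" for m n
    using relations(1)[of v m n] L_zero[of "m + n" v] that assms(3) by (cases "m = n") auto
  show ?thesis
    using assms(1)
  proof (cases rule: qindices_pos_cases)
    case a: (L m)
    show ?thesis using assms(2)
      by (cases rule: qindices_pos_cases) (use a assms LH LL in \<open>auto simp: G_zero opr_X opr_zero\<close>)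
  next
    case a: (H m)
    show ?thesis using assms(2)
      by (cases rule: qindices_pos_cases)
        (use a assms LH relations(3) in \<open>auto simp: G_zero opr_X opr_zero\<close>)
  next
    case a: (G m)
    then show ?thesis using assms by (simp add: G_zero opr_X opr_zero)
  qed
qed

lemma opr_scalar:
  assumes "a \<in> I" shows "\<exists>l. \<forall>v\<in>X. opr a v = l \<cdot> v"
proof (cases "parity a = 0")
  case True
  then show ?thesis using central_even_scalar[OF assms] opr_commute assms by blast
next
  case False
  obtain k where "a = Gx (of_int k - \<epsilon>)" "k > 0"
    by (rule qindices_pos_cases[OF assms]) (use False in auto)
  then show ?thesis by (intro exI[of _ 0]) (simp add: G_zero)
qed

subsection \<open>Identification with \<open>A(\<psi>)\<close>\<close>

lemma one_dimensional:
  obtains p w where "w \<in> part V p" "w \<noteq> 0" "X = vs.span {w}"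
proof -
  obtain u where u: "u \<in> X" "u \<noteq> 0" using X_nontrivial vs.subspace_0[OF X_subspace] by blast
  obtain a b where ab: "a \<in> part V 0" "b \<in> part V 1" "u = a + b" using X_decompose u(1) by blast
  obtain p w where w: "w \<in> part V p" "w \<noteq> 0"
    using ab u(2) by (cases "a = 0") auto
  have sub: "vs.span {w} \<subseteq> part V p"
    by (rule vs.span_minimal) (use w part_subspace in auto)
  have spX: "vs.span {w} \<subseteq> X" using sub part_X by blast
  have graded: "\<exists>a\<in>vs.span {w} \<inter> part V 0. \<exists>b\<in>vs.span {w} \<inter> part V 1. u = a + b"
    if "u \<in> vs.span {w}" for u
  proof (cases "p = 0")
    case True
    then show ?thesis using that sub vs.span_zero vs.subspace_0[OF part_subspace]
      by (intro bexI[of _ u] bexI[of _ 0]) auto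
  next
    case False
    then have "p = 1" by (cases p) auto
    then show ?thesis using that sub vs.span_zero vs.subspace_0[OF part_subspace]
      by (intro bexI[of _ 0] bexI[of _ u]) auto
  qed
  have "act V x u \<in> vs.span {w}" if x: "x \<in> underlying \<gg>" and u: "u \<in> vs.span {w}" for x u
  proof (rule invariant_under_basis[OF vs.subspace_span spX _ u x])
    fix a assume "a \<in> I"
    then obtain l where "opr a u = l \<cdot> u" using opr_scalar u spX by blast
    then show "opr a u \<in> vs.span {w}" using u by (simp add: vs.span_scale)
  qed
  then have "is_subsupermodule \<gg> V (vs.span {w})"
    unfolding is_subsupermodule_def using graded spX by auto
  moreover have "vs.span {w} \<noteq> {0}" using w(2) vs.span_base[of w "{w}"] by auto
  ultimately have "X = vs.span {w}" using submodule_cases by blast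
  then show thesis using that w by blast
qed

text \<open>
  The isomorphism is the coordinate with respect to the spanning vector \<open>w\<close>, whose parity \<open>p\<close> is the one
  required of \<open>A(\<psi>)\<close>, and \<open>\<psi>\<close> is the eigenvalue of the action on \<open>w\<close>. An odd element shifts \<open>w\<close> into
  the other part, which is zero, so \<open>\<psi>\<close> is even; on a bracket \<open>\<psi>\<close> vanishes because scalars commute
  and the sign \<open>- 1\<close> occurs only between odd elements.
\<close>

lemma isomorphic_to_character:
  "\<exists>\<psi> p. is_lie_super_hom \<gg> trivial_lie \<psi> \<and> supermodule_isomorphic \<gg> V (A_module \<psi> p)"
proof -
  obtain p w where w: "w \<in> part V p" "w \<noteq> 0" "X = vs.span {w}" by (rule one_dimensional)
  have X_eq: "v \<in> X \<longleftrightarrow> (\<exists>c. v = c \<cdot> w)" for v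
    by (auto simp: w(3) vs.span_singleton)
  define coord where "coord v = (THE c. v = c \<cdot> w)" for v
  have coord [simp]: "coord (c \<cdot> w) = c" for c
    unfolding coord_def using w(2) by (intro the_equality) auto
  have coord_inv: "v \<in> X \<Longrightarrow> coord v \<cdot> w = v" for v by (auto simp: X_eq)
  have wX: "w \<in> X" using part_X w(1) by blast
  have coord_add: "coord (u + v) = coord u + coord v" if "u \<in> X" "v \<in> X" for u v
    using that coord by (auto simp: X_eq simp flip: vs.scale_left_distrib)
  have coord_scale: "coord (c \<cdot> v) = c * coord v" if "v \<in> X" for c v
    using that by (auto simp: X_eq)
  have coord_0: "coord 0 = 0" using coord[of 0] by simp
  define \<psi> where "\<psi> x = coord (act V x w)" for x
  have \<psi>: "act V x w = \<psi> x \<cdot> w" if "x \<in> underlying \<gg>" for x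
    using coord_inv[OF act_X[OF that wX]] by (simp add: \<psi>_def)
  have odd_part: "v = 0" if "v \<in> part V (p + 1)" for v
  proof -
    have "v \<in> part V p"
      using part_X[OF that] vs.subspace_scale[OF part_subspace w(1)] by (auto simp: X_eq)
    then show ?thesis using that by (rule part_inter)
  qed
  have lin: "linear_between \<gg> trivial_lie \<psi>"
    using act_add_left act_scale_left act_X
    by (auto simp: linear_between_def smul_gg \<psi>_def wX coord_add coord_scale trivial_lie_def
        underlying_def[of "\<lparr>smul = _, part = _, brk = _\<rparr>"])
  have odd: "\<psi> x = 0" if "x \<in> part \<gg> 1" for x
    using odd_part[of "act V x w"] act_part[OF that w(1)] coord_0 by (simp add: \<psi>_def add.commute)
  have parts: "x \<in> underlying \<gg>" if "x \<in> part \<gg> i" for x i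
    using that by (auto simp: part_qq_pos[OF eps] underlying_gg span_part_def)
  have psi_add: "\<psi> (x + y) = \<psi> x + \<psi> y" if "x \<in> underlying \<gg>" "y \<in> underlying \<gg>" for x y
    using lin that by (simp add: linear_between_def)
  have lie: "is_lie_superalgebra \<gg>" by (rule qq_pos_is_lie_superalgebra[OF eps])
  have closed: "qbrk x y \<in> underlying \<gg>" if "x \<in> underlying \<gg>" "y \<in> underlying \<gg>" for x y
    using lie that by (auto simp: is_lie_superalgebra_def linear_between_def brk_gg)
  have hom_brk: "\<psi> (qbrk x y) = 0" if "x \<in> part \<gg> i" "y \<in> part \<gg> j" for x y i j
  proof -
    have "act V (qbrk x y) w = (\<psi> x * \<psi> y - koszul i j * \<psi> x * \<psi> y) \<cdot> w"
      using act_bracket[OF that wX]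
      by (simp add: \<psi> parts[OF that(1)] parts[OF that(2)] act_scale wX vs.scale_left_diff_distrib mult_ac)
    also have "\<psi> x * \<psi> y - koszul i j * \<psi> x * \<psi> y = 0"
      using odd that by (cases i; cases j) auto
    finally show ?thesis by (simp add: \<psi>_def coord_0)
  qed
  have brk_zero: "\<psi> (qbrk x y) = 0" if xy: "x \<in> underlying \<gg>" "y \<in> underlying \<gg>" for x y
  proof -
    obtain x0 x1 where x: "x0 \<in> part \<gg> 0" "x1 \<in> part \<gg> 1" "x = x0 + x1"
      using xy(1) unfolding underlying_def by blast
    obtain y0 y1 where y: "y0 \<in> part \<gg> 0" "y1 \<in> part \<gg> 1" "y = y0 + y1"
      using xy(2) unfolding underlying_def by blast
    have mem: "qbrk x0 y \<in> underlying \<gg>" "qbrk x1 y \<in> underlying \<gg>"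
      "qbrk x0 y0 \<in> underlying \<gg>" "qbrk x0 y1 \<in> underlying \<gg>"
      "qbrk x1 y0 \<in> underlying \<gg>" "qbrk x1 y1 \<in> underlying \<gg>"
      using x y xy by (auto intro!: closed intro: parts)
    have "\<psi> (qbrk x y) = \<psi> (qbrk x0 y) + \<psi> (qbrk x1 y)"
      unfolding x(3) qbrk_add_left using mem by (intro psi_add)
    also have "\<psi> (qbrk x0 y) = \<psi> (qbrk x0 y0) + \<psi> (qbrk x0 y1)"
      unfolding y(3) qbrk_add_right using mem by (intro psi_add)
    also have "\<psi> (qbrk x1 y) = \<psi> (qbrk x1 y0) + \<psi> (qbrk x1 y1)"
      unfolding y(3) qbrk_add_right using mem by (intro psi_add)
    finally show ?thesis using x y hom_brk by auto
  qed
  have "even_map \<gg> trivial_lie \<psi>"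
    unfolding even_map_def
  proof (intro allI ballI)
    fix i x assume "x \<in> part \<gg> i"
    then show "\<psi> x \<in> part trivial_lie i" by (cases i) (auto simp: trivial_lie_def odd)
  qed
  then have hom: "is_lie_super_hom \<gg> trivial_lie \<psi>"
    using lin brk_zero by (simp add: is_lie_super_hom_def brk_gg trivial_lie_def)
  have UA: "underlying (A_module \<psi> p) = UNIV"
    by (cases p) (auto simp: underlying_def A_module_def)
  have "supermodule_isomorphic \<gg> V (A_module \<psi> p)"
    unfolding supermodule_isomorphic_def
  proof (intro exI[of _ coord] conjI ballI)
    show "linear_between V (A_module \<psi> p) coord"
      by (simp add: linear_between_def UA coord_add coord_scale) (simp add: A_module_def)
    show "even_map V (A_module \<psi> p) coord"
      unfolding even_map_def
    proof (intro allI ballI)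
      fix i x assume "x \<in> part V i"
      then show "coord x \<in> part (A_module \<psi> p) i"
        using bit_cases_shift[of i p] odd_part coord_0 by (auto simp: A_module_def)
    qed
    show "bij_betw coord X (underlying (A_module \<psi> p))"
      unfolding UA by (rule bij_betw_byWitness[where f' = "\<lambda>c. c \<cdot> w"]) (auto simp: coord_inv X_eq)
    fix x v assume x: "x \<in> underlying \<gg>" and "v \<in> X"
    then obtain c where "v = c \<cdot> w" using X_eq by blast
    then show "coord (act V x v) = act (A_module \<psi> p) x (coord v)"
      using x wX by (simp add: act_scale \<psi> A_module_def mult.commute)
  qed
  then show ?thesis using hom by blast
qed

end

theorem theorem3p1:
  fixes \<epsilon> :: real
    and V :: "(qvec, 'v::ab_group_add) supermodule"
  assumes "\<epsilon> \<in> {0, 1/2}"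
    and "is_simple_supermodule (qq_pos \<epsilon>) V"
    and "finite_dim V"
  shows "\<exists>\<psi> p. is_lie_super_hom (qq_pos \<epsilon>) trivial_lie \<psi> \<and>
                supermodule_isomorphic (qq_pos \<epsilon>) V (A_module \<psi> p)"
  using fin_simple_module.isomorphic_to_character[of \<epsilon> V] assms
  by (simp add: fin_simple_module_def)

end
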